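(* Let $\mathfrak Q$ be a $q$-Boltzmann map with $\ell=1$, and let $\mathsf Q$ be the random submap of $\mathfrak Q$ defined via the right process (see context). Then $\mathsf Q$ cannot be obtained from an algorithmic peeling: there are no peeling algorithm $\mathcal A$ and stopping time $\tau$ of the associated peeling exploration $(\mathfrak e_n)_n$ of $\mathfrak Q$ such that almost surely $\mathsf Q=\mathfrak e_\tau$.
   Context: A planar map is a finite connected graph (loops and multiple edges allowed) properly embedded in the sphere, up to orientation-preserving homeomorphism, with a distinguished oriented edge (root edge). The root face is the face to the right of the root edge; its degree is the perimeter. A quadrangulation with boundary is a planar map all of whose non-root faces have degree 4; $\mathcal Q^\ell$ denotes those of perimeter $2\ell$. A quadrangulation with holes is a planar map with a (possibly empty) set of distinguished non-root faces (holes) of even degree, each with a marked oriented boundary edge, all other non-root faces having degree 4; hole boundaries are simple, pairwise vertex-disjoint cycles, marked edges are fixed by a deterministic rule. $\mathfrak q\subset\mathfrak p$ means that $\mathfrak p$ is obtained from $\mathfrak q$ by gluing in each hole $h$ a quadrangulation (possibly with holes) of perimeter $\deg h$, its root edge being identified with the marked edge of $h$. $q$-Boltzmann map with half-perimeter $\ell$ ($0<q\le1/12$): random $\mathfrak Q\in\mathcal Q^\ell$ with $\mathbb P(\mathfrak Q=\mathfrak q)\propto q^{\#\text{interior faces of }\mathfrak q}$. Peeling. A peeling algorithm is a function $\mathcal A$ which to each quadrangulation with at least one hole $\mathfrak e$ associates an edge of its active boundary (the edges adjacent to holes). The peeling exploration of $\mathfrak Q$ starts from $\mathfrak e_0$,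 the boundary cycle of length $2\ell$ with a single hole of degree $2\ell$. Given $\mathfrak e_n\subset\mathfrak Q$, let $e=\mathcal A(\mathfrak e_n)$. If the face of $\mathfrak Q$ on the hole side of $e$ is not a face of $\mathfrak e_n$ (type 1), $\mathfrak e_{n+1}$ is obtained by gluing a new quadrangle to $e$ inside the hole. Otherwise (type 2) $e$ is identified in $\mathfrak Q$ with another edge $\bar e$ of the same hole and $\mathfrak e_{n+1}$ is obtained by gluing $e$ to $\bar e$, splitting the hole into two (holes of degree 0 disappear). The exploration ends when no hole is left. Stopping times are with respect to the filtration generated by $(\mathfrak e_n)_n$. Definition of $\mathsf Q$. Work on the dual map of $\mathfrak Q\in\mathcal Q^1$: its root vertex (dual to the root face) has degree 2 and all other vertices have degree 4. Right process: start at $x_0=$ the root vertex, traverse the dual of the root edge to reach $x_1$, and then at each visited vertex leave along the rightmost dual edge (relative to the arrival direction) not yet visited, producing vertices $x_0,x_1,x_2,\dots$, until the first return $\tau^R_E$ to the root vertex. Let $\tau_I^R=\inf\{i\in\{1,\dots,\tau_E^R\}:x_i=x_j\text{ for some }j\ne i,\ j\in\{1,\dots,\tau_E^R\}\}$ and $\tau^R=\sup\{i\le\tau_E^R:x_i=x_{\tau_I^R}\}$. $\mathsf Q$ is the map with holes discovered by following the edges of the cycle $x_0,\dots,x_{\tau_I^R}=x_{\tau^R},x_{\tau^R+1},\dots,x_{\tau_E^R}$, i.e. the submap of $\mathfrak Q$ in which exactly the faces dual to the visited vertices of this cycle are revealed and exactly the primal edges dual to its steps are glued (if the right process has no self-intersection,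 the whole cycle $x_0,\dots,x_{\tau_E^R}$ is used). *)

theory Defs
  imports "HOL-Probability.Probability" "HOL-Combinatorics.Orbits" "HOL-Library.Extended_Nat"
begin

section \<open>Rooted planar maps with holes\<close>

text \<open>
  A map on an oriented surface is encoded by its darts (oriented edges). The involution \<open>opp\<close>
  reverses a dart; \<open>nxt d\<close> is the dart that follows \<open>d\<close> on the contour of the face lying to the
  right of \<open>d\<close>, so a face is a cycle of \<open>nxt\<close>, run through clockwise as seen from inside the face.
  The darts \<open>opp d\<close> and \<open>nxt d\<close> have the same origin, hence the darts with a given origin form a
  cycle of \<open>nxt \<circ> opp\<close>. The faces of degree 0 and the vertex map (no edge, hence no root edge)
  do not occur.
\<close>

record 'd hmap =
  darts :: "'d set"
  opp :: "'d \<Rightarrow> 'd"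
  nxt :: "'d \<Rightarrow> 'd"
  root :: 'd
  holes :: "'d set set"

definition face_at :: "'d hmap \<Rightarrow> 'd \<Rightarrow> 'd set" where
  "face_at m d = orbit (nxt m) d"

definition vertex_at :: "'d hmap \<Rightarrow> 'd \<Rightarrow> 'd set" where
  "vertex_at m d = orbit (nxt m \<circ> opp m) d"

definition faces :: "'d hmap \<Rightarrow> 'd set set" where
  "faces m = face_at m ` darts m"

definition vertices :: "'d hmap \<Rightarrow> 'd set set" where
  "vertices m = vertex_at m ` darts m"

definition edges :: "'d hmap \<Rightarrow> 'd set set" where
  "edges m = (\<lambda>d. {d, opp m d}) ` darts m"

definition root_face :: "'d hmap \<Rightarrow> 'd set" where
  "root_face m = face_at m (root m)"

text \<open>Embeddability in the sphere is expressed by Euler's formula.\<close>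

definition planar_map :: "'d hmap \<Rightarrow> bool" where
  "planar_map m \<longleftrightarrow>
     finite (darts m) \<and> root m \<in> darts m \<and>
     opp m permutes darts m \<and> (\<forall>d\<in>darts m. opp m d \<noteq> d \<and> opp m (opp m d) = d) \<and>
     nxt m permutes darts m \<and>
     (\<forall>d\<in>darts m. \<forall>d'\<in>darts m.
        (d, d') \<in> ({(x, opp m x) |x. x \<in> darts m} \<union> {(x, nxt m x) |x. x \<in> darts m})\<^sup>*) \<and>
     card (vertices m) + card (faces m) = card (edges m) + 2"

text \<open>
  The last conjunct says that no vertex is met twice by the contours of the holes, i.e. that these
  contours are simple and pairwise vertex-disjoint. The marked edge of a hole is a
  deterministic function of the map and is therefore not recorded.
\<close>

definition quadrangulation_with_holes :: "'d hmap \<Rightarrow> bool" where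
  "quadrangulation_with_holes m \<longleftrightarrow>
     planar_map m \<and>
     holes m \<subseteq> faces m - {root_face m} \<and>
     (\<forall>h\<in>holes m. even (card h)) \<and>
     (\<forall>f\<in>faces m - holes m - {root_face m}. card f = 4) \<and>
     (\<forall>d\<in>\<Union>(holes m). \<forall>d'\<in>\<Union>(holes m). vertex_at m d = vertex_at m d' \<longrightarrow> d = d')"

definition quadrangulation :: "nat \<Rightarrow> 'd hmap \<Rightarrow> bool" where
  "quadrangulation l m \<longleftrightarrow>
     planar_map m \<and> holes m = {} \<and> card (root_face m) = 2 * l \<and>
     (\<forall>f\<in>faces m - {root_face m}. card f = 4)"

text \<open>
  Root-preserving isomorphism of labelled maps is homeomorphism of rooted maps. A rooted connected
  map has no nontrivial automorphism.
\<close>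

definition hmap_iso :: "('c \<Rightarrow> 'd) \<Rightarrow> 'c hmap \<Rightarrow> 'd hmap \<Rightarrow> bool" where
  "hmap_iso f m m' \<longleftrightarrow>
     bij_betw f (darts m) (darts m') \<and>
     (\<forall>d\<in>darts m. f (opp m d) = opp m' (f d) \<and> f (nxt m d) = nxt m' (f d)) \<and>
     f (root m) = root m' \<and>
     holes m' = (\<lambda>h. f ` h) ` holes m"

definition isomorphic_hmap :: "'c hmap \<Rightarrow> 'd hmap \<Rightarrow> bool" where
  "isomorphic_hmap m m' \<longleftrightarrow> (\<exists>f. hmap_iso f m m')"


section \<open>Submaps\<close>

text \<open>
  Let \<open>F\<close> be a union of faces of \<open>m\<close> containing the root face and \<open>G \<subseteq> F\<close> a set of darts closed
  under \<open>opp m\<close>. In \<open>submap m F G\<close> exactly the faces in \<open>F\<close> are revealed and exactly the edges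
  with darts in \<open>G\<close> are glued. The dart \<open>d\<close> of a revealed face becomes \<open>Inl d\<close>. A side
  \<open>d \<in> F - G\<close> of a revealed face that is not glued is adjacent to a hole, and \<open>Inr d\<close> is the
  hole side of this edge. The contour of the hole continues after \<open>Inr d\<close> with the first
  side that is not glued when one turns in \<open>m\<close> around the origin of \<open>d\<close>, which is the end of
  \<open>Inr d\<close>, starting from \<open>d\<close> and staying in revealed faces.
\<close>

definition hole_nxt :: "'d hmap \<Rightarrow> 'd set \<Rightarrow> 'd \<Rightarrow> 'd" where
  "hole_nxt m G d =
     (let turn = (\<lambda>x. inv (nxt m) (opp m x))
      in (turn ^^ (LEAST k. 0 < k \<and> (turn ^^ k) (opp m d) \<notin> G)) (opp m d))"

definition submap_opp :: "'d hmap \<Rightarrow> 'd set \<Rightarrow> 'd set \<Rightarrow> 'd + 'd \<Rightarrow> 'd + 'd" where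
  "submap_opp m F G x =
     (case x of
        Inl d \<Rightarrow> if d \<in> G then Inl (opp m d) else if d \<in> F then Inr d else x
      | Inr d \<Rightarrow> if d \<in> F - G then Inl d else x)"

definition submap_nxt :: "'d hmap \<Rightarrow> 'd set \<Rightarrow> 'd set \<Rightarrow> 'd + 'd \<Rightarrow> 'd + 'd" where
  "submap_nxt m F G x =
     (case x of
        Inl d \<Rightarrow> if d \<in> F then Inl (nxt m d) else x
      | Inr d \<Rightarrow> if d \<in> F - G then Inr (hole_nxt m G d) else x)"

definition submap :: "'d hmap \<Rightarrow> 'd set \<Rightarrow> 'd set \<Rightarrow> ('d + 'd) hmap" where
  "submap m F G =
     \<lparr> darts = Inl ` F \<union> Inr ` (F - G),
       opp = submap_opp m F G,
       nxt = submap_nxt m F G,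
       root = Inl (root m),
       holes = (\<lambda>d. orbit (submap_nxt m F G) (Inr d)) ` (F - G) \<rparr>"


section \<open>Peeling explorations\<close>

text \<open>
  The selected edge of the active boundary is given by its dart on the hole side. The second
  conjunct says that the choice depends on the map only up to isomorphism.
\<close>

definition peeling_algorithm :: "('d hmap \<Rightarrow> 'd) \<Rightarrow> bool" where
  "peeling_algorithm A \<longleftrightarrow>
     (\<forall>e. quadrangulation_with_holes e \<and> holes e \<noteq> {} \<longrightarrow> A e \<in> \<Union>(holes e)) \<and>
     (\<forall>e e' f. quadrangulation_with_holes e \<and> quadrangulation_with_holes e' \<and> holes e \<noteq> {} \<and>
        hmap_iso f e e' \<longrightarrow> A e' = f (A e))"

text \<open>
  The state of the exploration of \<open>m\<close> consists of the darts of the revealed faces and the glued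
  darts. If the face of \<open>m\<close> across the selected edge is not revealed, it is glued to this edge
  (type 1); otherwise the edge is glued to the side \<open>opp m d\<close> of a revealed face with which it
  is identified in \<open>m\<close> (type 2). Once no hole is left the exploration stays constant.
\<close>

fun peel_state :: "(('d + 'd) hmap \<Rightarrow> 'd + 'd) \<Rightarrow> 'd hmap \<Rightarrow> nat \<Rightarrow> 'd set \<times> 'd set" where
  "peel_state A m 0 = (root_face m, {})"
| "peel_state A m (Suc n) =
     (let (F, G) = peel_state A m n in
      if holes (submap m F G) = {} then (F, G)
      else let d = projr (A (submap m F G)) in
        if opp m d \<notin> F then (F \<union> face_at m (opp m d), G \<union> {d, opp m d})
        else (F, G \<union> {d, opp m d}))"

definition exploration :: "(('d + 'd) hmap \<Rightarrow> 'd + 'd) \<Rightarrow> 'd hmap \<Rightarrow> nat \<Rightarrow> ('d + 'd) hmap" where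
  "exploration A m n = (case peel_state A m n of (F, G) \<Rightarrow> submap m F G)"


section \<open>The submap discovered by the right process\<close>

text \<open>
  A step of a dual path is encoded by the primal dart \<open>d\<close> that it crosses from right to left: it
  leads from the face of \<open>d\<close> to the face of \<open>opp m d\<close>. As faces are oriented clockwise,
  after entering a face through its side \<open>s = opp m d\<close> the exits listed from right to left
  are the \<open>nxt\<close>-predecessor of \<open>s\<close>, the predecessor of that side, and so on. The second component
  collects both darts of every edge crossed so far.
\<close>

fun right_state :: "'d hmap \<Rightarrow> nat \<Rightarrow> 'd \<times> 'd set" where
  "right_state m 0 = (root m, {root m, opp m (root m)})"
| "right_state m (Suc n) =
     (let (d, V) = right_state m n;
          s = opp m d;
          d' = (inv (nxt m) ^^ (LEAST k. (inv (nxt m) ^^ k) s \<notin> V)) s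
      in (d', V \<union> {d', opp m d'}))"

text \<open>\<open>right_step m i\<close> is crossed between \<open>right_face m i\<close> and \<open>right_face m (Suc i)\<close>.\<close>

definition right_step :: "'d hmap \<Rightarrow> nat \<Rightarrow> 'd" where
  "right_step m i = fst (right_state m i)"

fun right_face :: "'d hmap \<Rightarrow> nat \<Rightarrow> 'd set" where
  "right_face m 0 = root_face m"
| "right_face m (Suc i) = face_at m (opp m (right_step m i))"

definition tau_E :: "'d hmap \<Rightarrow> nat" where
  "tau_E m = Inf {i. 1 \<le> i \<and> right_face m i = root_face m}"

definition self_meeting_times :: "'d hmap \<Rightarrow> nat set" where
  "self_meeting_times m =
     {i \<in> {1..tau_E m}. \<exists>j\<in>{1..tau_E m}. j \<noteq> i \<and> right_face m i = right_face m j}"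

definition tau_I :: "'d hmap \<Rightarrow> nat" where
  "tau_I m = Inf (self_meeting_times m)"

definition tau_R :: "'d hmap \<Rightarrow> nat" where
  "tau_R m = Sup {i. i \<le> tau_E m \<and> right_face m i = right_face m (tau_I m)}"

definition cycle_times :: "'d hmap \<Rightarrow> nat set" where
  "cycle_times m =
     (if self_meeting_times m = {} then {0..tau_E m} else {0..tau_I m} \<union> {tau_R m..tau_E m})"

definition cycle_steps :: "'d hmap \<Rightarrow> nat set" where
  "cycle_steps m =
     (if self_meeting_times m = {} then {0..<tau_E m} else {0..<tau_I m} \<union> {tau_R m..<tau_E m})"

definition right_submap :: "'d hmap \<Rightarrow> ('d + 'd) hmap" where
  "right_submap m =
     submap m (\<Union>i\<in>cycle_times m. right_face m i)
              (\<Union>i\<in>cycle_steps m. {right_step m i, opp m (right_step m i)})"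


section \<open>Boltzmann maps and stopping times\<close>

text \<open>
  Random maps take values in labelled maps on natural numbers. Only the law of the isomorphism
  class is prescribed, and the filtration below contains only the information given by the
  isomorphism classes of the explored maps.
\<close>

definition boltzmann_map :: "real \<Rightarrow> nat \<Rightarrow> 'w measure \<Rightarrow> ('w \<Rightarrow> nat hmap) \<Rightarrow> bool" where
  "boltzmann_map q l M Q \<longleftrightarrow>
     prob_space M \<and>
     Q \<in> M \<rightarrow>\<^sub>M count_space {m. quadrangulation l m} \<and>
     (\<exists>Z>0. \<forall>m :: nat hmap. quadrangulation l m \<longrightarrow>
        measure M {\<omega> \<in> space M. isomorphic_hmap (Q \<omega>) m} = q ^ card (faces m - {root_face m}) / Z)"

text \<open>
  The index \<open>\<infinity>\<close> is included since stopping times may be infinite. The isomorphism classes of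
  finite maps being countably many, the events below generate the \<open>\<sigma>\<close>-algebra of the explored
  maps up to time \<open>t\<close>.
\<close>

definition exploration_filtration ::
    "((nat + nat) hmap \<Rightarrow> nat + nat) \<Rightarrow> 'w measure \<Rightarrow> ('w \<Rightarrow> nat hmap) \<Rightarrow> enat \<Rightarrow> 'w measure" where
  "exploration_filtration A M Q t =
     sigma (space M)
       {{\<omega> \<in> space M. isomorphic_hmap (exploration A (Q \<omega>) n) e} |n (e :: (nat + nat) hmap). enat n \<le> t}"

end

(*
  Two maps with two inner faces suffice; for them the stopping time plays no role. In both maps
  the root edge and the other edge of the root face lead to distinct inner faces. As long as only
  these two edges have been peeled, the explored maps coincide for the two maps, and hence so does
  the choice of the algorithm. Apart from these two edges, the right process keeps one edge of the
  first map and one of the second, and these correspond to disjoint pairs of sides of the inner faces.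
  Thus the first other side that is peeled is wrong for one of the two maps: there, every later
  explored map has an edge that is not glued in the submap of the right process, while the earlier
  ones have the wrong number of darts. Both maps have positive probability, and everything is
  equivariant under relabelling of the darts.
*)

theory Submission
  imports Defs
begin

text \<open>Whether side 5 of the first inner face belongs to the final cycle depends on what lies
  across it, and a peeling learns this only by gluing that side, which cannot be undone. Counting
  darts does not exclude every state after a wrong gluing, as such a state can have as many darts as
  the submap of the right process. Rigidity of rooted maps is used instead: an isomorphism fixes the
  root, hence every dart reached from it along sides and edges present in both submaps. In both maps
  a wrong edge joins two sides of one inner face, so it suffices that this face is attached to the
  root face, even if the other one is not yet revealed. A second difficulty is that outcomes of the
  random map carry arbitrary labels. Outcomes realising the two maps need unrelated relabellings,
  which turn the single algorithm into two choice functions. Agreement with it is ensured only where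
  a peeling algorithm is constrained, on quadrangulations with at least one hole; hence the four
  states that can precede the first inner gluing are checked explicitly.\<close>

section \<open>Maps given by lists of cycles\<close>

text \<open>The equation \<open>map f xs = rotate1 xs\<close> makes \<open>f\<close> advance
  cyclically along \<open>xs\<close>, so powers of \<open>f\<close> are index shifts modulo the
  length. Orbits in explicit maps thereby reduce to equations between lists that simplification
  decides.\<close>

lemma orbit_cycle_list:
  assumes "map f xs = rotate1 xs" and "x \<in> set xs"
  shows "orbit f x = set xs"
proof -
  have step: "f (xs ! i) = xs ! (Suc i mod length xs)" if "i < length xs" for i
    using that assms(1) by (metis nth_map nth_rotate1)
  have pow: "(f ^^ k) (xs ! i) = xs ! ((i + k) mod length xs)" if "i < length xs" for i k
  proof (induction k)
    case 0
    then show ?case using that by simp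
  next
    case (Suc k)
    have "(i + k) mod length xs < length xs" using that by (intro mod_less_divisor) auto
    then show ?case using step[of "(i + k) mod length xs"] Suc by (simp add: mod_Suc_eq)
  qed
  obtain i where i: "i < length xs" "x = xs ! i"
    using assms(2) by (metis in_set_conv_nth)
  have orb: "orbit f x = {(f ^^ n) x |n. 0 < n}" by (rule orbit_altdef)
  show ?thesis
  proof
    have "(f ^^ n) x \<in> set xs" for n
    proof -
      have "(i + n) mod length xs < length xs" using i(1) by (intro mod_less_divisor) auto
      then show ?thesis using pow[OF i(1), of n] i(2) nth_mem by metis
    qed
    then show "orbit f x \<subseteq> set xs" unfolding orb by blast
    show "set xs \<subseteq> orbit f x"
    proof
      fix y assume "y \<in> set xs"
      then obtain j where j: "j < length xs" "y = xs ! j" by (metis in_set_conv_nth)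
      \<comment> \<open>Going around the end of the list avoids a truncated subtraction when
        \<open>j < i\<close> and keeps the exponent positive, as \<open>orbit\<close> asks for at
        least one application.\<close>
      let ?k = "length xs - i + j"
      have "(f ^^ ?k) x = y" using pow[OF i(1), of ?k] i j by simp
      moreover have "0 < ?k" using i by simp
      ultimately show "y \<in> orbit f x" unfolding orb by blast
    qed
  qed
qed

lemma orbits_cycle_lists:
  assumes "\<forall>xs\<in>set xss. map f xs = rotate1 xs" and "[] \<notin> set xss"
  shows "orbit f ` set (concat xss) = set ` set xss"
proof -
  have "orbit f ` set xs = {set xs}" if "xs \<in> set xss" for xs
  proof -
    have "map f xs = rotate1 xs" "xs \<noteq> []" using that assms by auto
    then show ?thesis using orbit_cycle_list[of f xs] by (auto simp: image_constant_conv)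
  qed
  then have "(\<Union>xs\<in>set xss. orbit f ` set xs) = (\<Union>xs\<in>set xss. {set xs})"
    by (rule SUP_cong[OF refl])
  then show ?thesis by (simp add: image_UN UNION_singleton_eq_range)
qed

lemma card_cycle_lists:
  assumes "distinct (concat xss)" and "[] \<notin> set xss"
  shows "card (set ` set xss) = length xss"
  using assms
proof (induction xss)
  case (Cons xs xss)
  have "set xs \<notin> set ` set xss"
    using Cons.prems by (cases xs) auto
  then show ?case using Cons by simp
qed simp

lemma permutes_cycle_lists:
  assumes "\<forall>xs\<in>set xss. map f xs = rotate1 xs" and "distinct (concat xss)"
    and "\<And>x. x \<notin> set (concat xss) \<Longrightarrow> f x = x"
  shows "f permutes set (concat xss)"
proof -
  have "f ` set xs = set xs" if "xs \<in> set xss" for xs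
    using that assms(1) by (metis list.set_map set_rotate1)
  then have img: "f ` set (concat xss) = set (concat xss)" by (auto simp: image_UN)
  show ?thesis
  proof (rule bij_imp_permutes)
    show "bij_betw f (set (concat xss)) (set (concat xss))"
      unfolding bij_betw_def using img eq_card_imp_inj_on[of "set (concat xss)" f]
      by (metis finite_set)
  qed (rule assms(3))
qed

lemma closed_walk_rtrancl:
  assumes "successively (\<lambda>x y. (x, y) \<in> R) xs" and "i \<le> j" "j < length xs"
  shows "(xs ! i, xs ! j) \<in> R\<^sup>*"
  using assms(2,3)
proof (induction j rule: dec_induct)
  case (step j)
  have "(xs ! j, xs ! Suc j) \<in> R"
    using assms(1) step by (simp add: successively_conv_nth)
  then show ?case using step by auto
qed auto

text \<open>A certificate for planarity: the cycles of faces, vertices and edges as lists, whose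
  numbers enter Euler's formula, and a closed walk \<open>ws\<close> through all darts for
  connectedness.\<close>

lemma planar_mapI:
  assumes faces: "\<forall>xs\<in>set fss. map (nxt m) xs = rotate1 xs" "[] \<notin> set fss" "distinct (concat fss)"
    and vertices: "\<forall>xs\<in>set vss. map (nxt m \<circ> opp m) xs = rotate1 xs" "[] \<notin> set vss"
      "distinct (concat vss)"
    and edges: "\<forall>xs\<in>set ess. map (opp m) xs = rotate1 xs" "\<forall>xs\<in>set ess. length xs = 2"
      "distinct (concat ess)"
    and darts: "darts m = set (concat fss)" "darts m = set (concat vss)" "darts m = set (concat ess)"
    and root: "root m \<in> darts m"
    and walk: "successively (\<lambda>x y. opp m x = y \<or> nxt m x = y) (ws @ ws)" "set ws = darts m"
    and outside: "\<And>x. x \<notin> darts m \<Longrightarrow> opp m x = x" "\<And>x. x \<notin> darts m \<Longrightarrow> nxt m x = x"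
    and euler: "length vss + length fss = length ess + 2"
  shows "planar_map m"
proof -
  let ?R = "{(x, opp m x) |x. x \<in> darts m} \<union> {(x, nxt m x) |x. x \<in> darts m}"
  have e: "opp m permutes darts m"
    using permutes_cycle_lists[OF edges(1,3)] outside(1) darts(3) by simp
  have n: "nxt m permutes darts m"
    using permutes_cycle_lists[OF faces(1,3)] outside(2) darts(1) by simp
  have pair: "\<exists>x y. xs = [x, y] \<and> x \<noteq> y \<and> opp m x = y \<and> opp m y = x" if "xs \<in> set ess" for xs
  proof -
    have "length xs = 2" using edges(2) that by blast
    then obtain x y where xy: "xs = [x, y]"
      by (auto simp: numeral_2_eq_2 length_Suc_conv)
    have "distinct xs" using edges(3) that by (simp add: distinct_concat_iff)
    moreover have "map (opp m) xs = rotate1 xs" using edges(1) that by blast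
    ultimately show ?thesis using xy by simp
  qed
  have inv: "\<forall>d\<in>darts m. opp m d \<noteq> d \<and> opp m (opp m d) = d"
  proof
    fix d assume "d \<in> darts m"
    then obtain xs where "xs \<in> set ess" "d \<in> set xs" by (auto simp: darts(3))
    with pair[of xs] show "opp m d \<noteq> d \<and> opp m (opp m d) = d" by auto
  qed
  have "(\<lambda>d. {d, opp m d}) ` set (concat ess) = set ` set ess"
  proof -
    have "(\<lambda>d. {d, opp m d}) ` set xs = {set xs}" if "xs \<in> set ess" for xs
      using pair[OF that] by auto
    then have "(\<Union>xs\<in>set ess. (\<lambda>d. {d, opp m d}) ` set xs) = (\<Union>xs\<in>set ess. {set xs})"
      by (rule SUP_cong[OF refl])
    then show ?thesis by (simp add: image_UN UNION_singleton_eq_range)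
  qed
  moreover have "[] \<notin> set ess" using edges(2) by fastforce
  ultimately have ce: "card (edges m) = length ess"
    using card_cycle_lists[OF edges(3)] by (simp add: edges_def darts(3))
  have cf: "card (faces m) = length fss"
    using orbits_cycle_lists[OF faces(1,2)] card_cycle_lists[OF faces(3,2)]
    unfolding faces_def face_at_def[abs_def] darts(1) by metis
  have cv: "card (vertices m) = length vss"
    using orbits_cycle_lists[OF vertices(1,2)] card_cycle_lists[OF vertices(3,2)]
    unfolding vertices_def vertex_at_def[abs_def] darts(2) by metis
  have conn: "(d, d') \<in> ?R\<^sup>*" if d: "d \<in> darts m" "d' \<in> darts m" for d d'
  proof -
    \<comment> \<open>In the doubled walk every dart of the second copy comes after every dart of
      the first, so the order of \<open>d\<close> and \<open>d'\<close> on the walk does not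
      matter.\<close>
    have walk': "successively (\<lambda>x y. (x, y) \<in> ?R) (ws @ ws)"
    proof (rule successively_mono[OF walk(1)])
      fix x y assume "x \<in> set (ws @ ws)" "y \<in> set (ws @ ws)" "opp m x = y \<or> nxt m x = y"
      then show "(x, y) \<in> ?R" using walk(2) by auto
    qed
    obtain i where i: "i < length ws" "ws ! i = d"
      using d(1) unfolding walk(2)[symmetric] in_set_conv_nth by blast
    obtain j where j: "j < length ws" "ws ! j = d'"
      using d(2) unfolding walk(2)[symmetric] in_set_conv_nth by blast
    show ?thesis
      using closed_walk_rtrancl[OF walk', of i "length ws + j"] i j by (simp add: nth_append)
  qed
  show ?thesis
    unfolding planar_map_def
  proof (intro conjI ballI)
    show "finite (darts m)" by (simp add: darts(1))
    show "card (vertices m) + card (faces m) = card (edges m) + 2" using ce cf cv euler by simp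
  qed (simp_all add: root e n inv conn)
qed

lemma faces_cycle_lists:
  assumes "\<forall>xs\<in>set fss. map (nxt m) xs = rotate1 xs" "[] \<notin> set fss" "darts m = set (concat fss)"
  shows "faces m = set ` set fss"
  using orbits_cycle_lists[OF assms(1,2)] unfolding faces_def face_at_def[abs_def] assms(3) .

text \<open>Tailored to a single hole \<open>hs\<close>. Simplicity of its contour becomes the check
  that no vertex cycle contains two of its darts.\<close>

lemma quadrangulation_with_holesI:
  assumes planar: "planar_map m"
    and faces: "\<forall>xs\<in>set (rs # hs # qss). map (nxt m) xs = rotate1 xs" "[] \<notin> set (rs # hs # qss)"
      "distinct (concat (rs # hs # qss))"
    and darts: "darts m = set (concat (rs # hs # qss))"
    and root: "root m \<in> set rs"
    and holes: "holes m = face_at m ` set hs"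
    and lengths: "even (length hs)" "\<forall>xs\<in>set qss. length xs = 4"
    and vertices: "\<forall>xs\<in>set vss. map (nxt m \<circ> opp m) xs = rotate1 xs"
      "set hs \<subseteq> set (concat vss)" "\<forall>xs\<in>set vss. length (filter (\<lambda>x. x \<in> set hs) xs) \<le> 1"
  shows "quadrangulation_with_holes m"
proof -
  have f: "faces m = set ` set (rs # hs # qss)"
    by (rule faces_cycle_lists[OF faces(1,2) darts])
  have r: "root_face m = set rs"
    using orbit_cycle_list[of "nxt m" rs "root m"] faces(1) root
    by (simp add: root_face_def face_at_def)
  have "face_at m ` set hs = {set hs}"
    using orbit_cycle_list[of "nxt m" hs] faces(1,2)
    by (auto simp: face_at_def image_constant_conv)
  then have h: "holes m = {set hs}" by (simp add: holes)
  have nr: "set hs \<noteq> set rs" using faces(2,3) root by auto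
  have vert: "d = d'" if d: "d \<in> set hs" "d' \<in> set hs" "vertex_at m d = vertex_at m d'" for d d'
  proof -
    obtain xs where xs: "xs \<in> set vss" "d \<in> set xs" using vertices(2) d(1) by auto
    obtain ys where ys: "ys \<in> set vss" "d' \<in> set ys" using vertices(2) d(2) by auto
    have "vertex_at m d = set xs" "vertex_at m d' = set ys"
      using orbit_cycle_list[of "nxt m \<circ> opp m"] vertices(1) xs ys by (auto simp: vertex_at_def)
    then have "d' \<in> set xs" using d(3) ys by simp
    have "card (set (filter (\<lambda>x. x \<in> set hs) xs)) \<le> 1"
      using vertices(3) xs(1) card_length[of "filter (\<lambda>x. x \<in> set hs) xs"] by fastforce
    moreover have "{d, d'} \<subseteq> set (filter (\<lambda>x. x \<in> set hs) xs)"
      using xs(2) d(1,2) \<open>d' \<in> set xs\<close> by auto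
    ultimately have "card {d, d'} \<le> 1"
      using card_mono[of "set (filter (\<lambda>x. x \<in> set hs) xs)" "{d, d'}"] by simp
    then show ?thesis by (cases "d = d'") auto
  qed
  show ?thesis
    unfolding quadrangulation_with_holes_def
  proof (intro conjI)
    show "holes m \<subseteq> faces m - {root_face m}" using nr by (simp add: h f r)
    show "\<forall>k\<in>holes m. even (card k)"
      using lengths(1) faces(3) by (simp add: h distinct_card)
    show "\<forall>k\<in>faces m - holes m - {root_face m}. card k = 4"
      using lengths(2) faces(3) by (auto simp: h f r distinct_concat_iff distinct_card)
    show "\<forall>d\<in>\<Union>(holes m). \<forall>d'\<in>\<Union>(holes m). vertex_at m d = vertex_at m d' \<longrightarrow> d = d'"
      using vert by (simp add: h)
  qed (rule planar)
qed

section \<open>Relabelling of darts\<close>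

text \<open>Unlike \<open>hmap_iso\<close>, which compares \<open>opp\<close> and \<open>nxt\<close>
  on the darts only, this transports the whole record, so that invariance of a construction becomes
  an equation to rewrite with.\<close>

definition relabel :: "('c \<Rightarrow> 'd) \<Rightarrow> 'c hmap \<Rightarrow> 'd hmap" where
  "relabel f m =
     \<lparr> darts = f ` darts m, opp = f \<circ> opp m \<circ> inv f, nxt = f \<circ> nxt m \<circ> inv f,
       root = f (root m), holes = (\<lambda>h. f ` h) ` holes m \<rparr>"

lemma relabel_sel [simp]:
  "darts (relabel f m) = f ` darts m" "opp (relabel f m) = f \<circ> opp m \<circ> inv f"
  "nxt (relabel f m) = f \<circ> nxt m \<circ> inv f" "root (relabel f m) = f (root m)"
  "holes (relabel f m) = (\<lambda>h. f ` h) ` holes m"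
  by (simp_all add: relabel_def)

lemma hmap_iso_relabel: "inj f \<Longrightarrow> hmap_iso f m (relabel f m)"
  by (auto simp: hmap_iso_def bij_betw_def intro: inj_on_subset)

lemma relabel_inv:
  fixes m :: "'d hmap"
  assumes "bij f"
  shows "relabel (inv f) (relabel f m) = m"
proof (rule hmap.equality)
  have "inv f (f x) = x" "inv (inv f) = f" for x
    using assms by (simp_all add: bij_is_inj inv_inv_eq)
  then show "opp (relabel (inv f) (relabel f m)) = opp m" "nxt (relabel (inv f) (relabel f m)) = nxt m"
    "darts (relabel (inv f) (relabel f m)) = darts m" "root (relabel (inv f) (relabel f m)) = root m"
    "holes (relabel (inv f) (relabel f m)) = holes m"
    by (simp_all add: fun_eq_iff image_image)
qed simp

lemma conj_funpow:
  assumes "inj f"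
  shows "((f \<circ> p \<circ> inv f) ^^ k) (f x) = f ((p ^^ k) x)"
  by (induction k) (simp_all add: assms)

lemma conj_orbit:
  assumes "inj f"
  shows "orbit (f \<circ> p \<circ> inv f) (f x) = f ` orbit p x"
  unfolding orbit_altdef conj_funpow[OF assms] by auto

lemma conj_inv:
  assumes "bij f" "bij p"
  shows "inv (f \<circ> p \<circ> inv f) = f \<circ> inv p \<circ> inv f"
  by (rule inv_unique_comp) (use assms in \<open>auto simp: fun_eq_iff bij_is_inj bij_is_surj surj_f_inv_f\<close>)

lemma conj_permutes:
  assumes "bij f" "p permutes S"
  shows "(f \<circ> p \<circ> inv f) permutes f ` S"
proof (rule bij_imp_permutes)
  show "bij_betw (f \<circ> p \<circ> inv f) (f ` S) (f ` S)"
  proof (intro bij_betw_trans[where B = S])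
    show "bij_betw (inv f) (f ` S) S"
      by (rule bij_betw_byWitness[where f' = f]) (use assms(1) in \<open>auto simp: bij_is_inj\<close>)
    show "bij_betw p S S" using assms(2) by (rule permutes_imp_bij)
    show "bij_betw f S (f ` S)"
      using assms(1) by (auto simp: bij_betw_def bij_def intro: inj_on_subset)
  qed
  fix x assume "x \<notin> f ` S"
  then have "inv f x \<notin> S" using assms(1) by (metis bij_inv_eq_iff imageI)
  then show "(f \<circ> p \<circ> inv f) x = x"
    using assms by (simp add: permutes_not_in bij_is_surj surj_f_inv_f)
qed

lemma face_at_relabel: "inj f \<Longrightarrow> face_at (relabel f m) (f d) = f ` face_at m d"
  by (simp add: face_at_def conj_orbit)

lemma vertex_at_relabel: "inj f \<Longrightarrow> vertex_at (relabel f m) (f d) = f ` vertex_at m d"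
proof -
  assume f: "inj f"
  have "(f \<circ> nxt m \<circ> inv f) \<circ> (f \<circ> opp m \<circ> inv f) = f \<circ> (nxt m \<circ> opp m) \<circ> inv f"
    by (simp add: fun_eq_iff f)
  then show ?thesis using f by (simp add: vertex_at_def conj_orbit)
qed

lemma planar_map_relabel:
  assumes f: "bij f" and m: "planar_map m"
  shows "planar_map (relabel f m)"
proof -
  have i: "inj f" using f by (rule bij_is_inj)
  have inj_im: "inj_on (\<lambda>h. f ` h) X" for X using i by (auto simp: inj_on_def inj_image_eq_iff)
  have "faces (relabel f m) = (\<lambda>h. f ` h) ` faces m"
    by (simp add: faces_def image_image face_at_relabel[OF i])
  then have cf: "card (faces (relabel f m)) = card (faces m)" by (simp add: card_image[OF inj_im])
  have "vertices (relabel f m) = (\<lambda>h. f ` h) ` vertices m"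
    by (simp add: vertices_def image_image vertex_at_relabel[OF i])
  then have cv: "card (vertices (relabel f m)) = card (vertices m)" by (simp add: card_image[OF inj_im])
  have "edges (relabel f m) = (\<lambda>h. f ` h) ` edges m"
    by (simp add: edges_def image_image i)
  then have ce: "card (edges (relabel f m)) = card (edges m)" by (simp add: card_image[OF inj_im])
  let ?R = "\<lambda>m. {(x, opp m x) |x. x \<in> darts m} \<union> {(x, nxt m x) |x. x \<in> darts m}"
  have "(f d, f d') \<in> (?R (relabel f m))\<^sup>*" if "(d, d') \<in> (?R m)\<^sup>*" for d d'
    using that
  proof (induction rule: rtrancl_induct)
    case (step y z)
    have "(f y, f z) \<in> ?R (relabel f m)" using step(2) i by auto
    then show ?case using step(3) by (rule rtrancl_into_rtrancl[rotated])
  qed simp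
  then have conn: "\<forall>d\<in>darts (relabel f m). \<forall>d'\<in>darts (relabel f m).
      (d, d') \<in> (?R (relabel f m))\<^sup>*"
    using m unfolding planar_map_def by (simp only: relabel_sel) blast
  show ?thesis
    unfolding planar_map_def
  proof (intro conjI)
    show "opp (relabel f m) permutes darts (relabel f m)"
      "nxt (relabel f m) permutes darts (relabel f m)"
      using m by (simp_all add: planar_map_def conj_permutes[OF f])
    show "\<forall>d\<in>darts (relabel f m). opp (relabel f m) d \<noteq> d \<and>
        opp (relabel f m) (opp (relabel f m) d) = d"
      using m i by (auto simp: planar_map_def inj_eq)
  qed (use m conn cf cv ce in \<open>simp_all only: planar_map_def relabel_sel finite_imageI imageI\<close>)
qed

lemma quadrangulation_with_holes_relabel:
  assumes f: "bij f" and m: "quadrangulation_with_holes m"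
  shows "quadrangulation_with_holes (relabel f m)"
proof -
  have i: "inj f" using f by (rule bij_is_inj)
  have fa: "faces (relabel f m) = (\<lambda>h. f ` h) ` faces m"
    by (simp add: faces_def image_image face_at_relabel[OF i])
  have r: "root_face (relabel f m) = f ` root_face m"
    by (simp add: root_face_def face_at_relabel[OF i])
  have c: "card (f ` h) = card h" for h
    by (rule card_image) (use i in \<open>auto intro: inj_on_subset\<close>)
  show ?thesis
    unfolding quadrangulation_with_holes_def
  proof (intro conjI)
    show "planar_map (relabel f m)"
      using f m by (intro planar_map_relabel) (auto simp: quadrangulation_with_holes_def)
    show "holes (relabel f m) \<subseteq> faces (relabel f m) - {root_face (relabel f m)}"
      using m by (auto simp: quadrangulation_with_holes_def fa r inj_image_eq_iff[OF i])
    show "\<forall>h\<in>holes (relabel f m). even (card h)"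
      using m by (auto simp: quadrangulation_with_holes_def c)
    show "\<forall>h\<in>faces (relabel f m) - holes (relabel f m) - {root_face (relabel f m)}. card h = 4"
    proof
      fix h assume "h \<in> faces (relabel f m) - holes (relabel f m) - {root_face (relabel f m)}"
      then obtain k where "h = f ` k" "k \<in> faces m - holes m - {root_face m}"
        unfolding fa r by auto
      then show "card h = 4" using m by (simp add: quadrangulation_with_holes_def c)
    qed
    show "\<forall>d\<in>\<Union>(holes (relabel f m)). \<forall>d'\<in>\<Union>(holes (relabel f m)).
        vertex_at (relabel f m) d = vertex_at (relabel f m) d' \<longrightarrow> d = d'"
    proof (intro ballI impI)
      fix d d'
      assume "d \<in> \<Union>(holes (relabel f m))" "d' \<in> \<Union>(holes (relabel f m))"
        and v: "vertex_at (relabel f m) d = vertex_at (relabel f m) d'"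
      then obtain x x' where x: "x \<in> \<Union>(holes m)" "x' \<in> \<Union>(holes m)" "d = f x" "d' = f x'"
        by auto
      then have "vertex_at m x = vertex_at m x'"
        using v by (simp add: vertex_at_relabel[OF i] inj_image_eq_iff[OF i])
      then show "d = d'" using m x unfolding quadrangulation_with_holes_def by blast
    qed
  qed
qed

lemma isomorphic_hmap_relabel_cancel:
  assumes g: "bij g" and iso: "isomorphic_hmap (relabel g e) (relabel g e')"
  shows "isomorphic_hmap e e'"
proof -
  obtain f where f: "hmap_iso f (relabel g e) (relabel g e')"
    using iso by (auto simp: isomorphic_hmap_def)
  have i: "inj g" "surj g" using g by (auto simp: bij_def)
  have k: "inv g (g x) = x" "g (inv g y) = y" for x y using i by (auto simp: surj_f_inv_f)
  have "bij_betw (inv g \<circ> f \<circ> g) (darts e) (darts e')"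
  proof -
    have "bij_betw g (darts e) (g ` darts e)" "bij_betw (inv g) (g ` darts e') (darts e')"
      using i by (auto simp: bij_betw_def inj_on_def image_image k(1))
    moreover have "bij_betw f (g ` darts e) (g ` darts e')" using f by (simp add: hmap_iso_def)
    ultimately show ?thesis by (blast intro: bij_betw_trans)
  qed
  moreover have "(inv g \<circ> f \<circ> g) (opp e d) = opp e' ((inv g \<circ> f \<circ> g) d) \<and>
      (inv g \<circ> f \<circ> g) (nxt e d) = nxt e' ((inv g \<circ> f \<circ> g) d)" if "d \<in> darts e" for d
  proof -
    have "f (opp (relabel g e) (g d)) = opp (relabel g e') (f (g d))"
      "f (nxt (relabel g e) (g d)) = nxt (relabel g e') (f (g d))"
      using f that by (auto simp: hmap_iso_def)
    then show ?thesis by (simp add: k)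
  qed
  moreover have "(inv g \<circ> f \<circ> g) (root e) = root e'"
    using f by (simp add: hmap_iso_def k)
  moreover have "holes e' = (\<lambda>h. (inv g \<circ> f \<circ> g) ` h) ` holes e"
  proof -
    have "(\<lambda>h. g ` h) ` holes e' = (\<lambda>h. f ` h) ` (\<lambda>h. g ` h) ` holes e"
      using f by (simp add: hmap_iso_def)
    then have "(\<lambda>h. inv g ` h) ` (\<lambda>h. g ` h) ` holes e'
        = (\<lambda>h. inv g ` h) ` (\<lambda>h. f ` h) ` (\<lambda>h. g ` h) ` holes e" by simp
    then show ?thesis by (simp add: image_image k)
  qed
  ultimately show ?thesis
    unfolding isomorphic_hmap_def hmap_iso_def by blast
qed

text \<open>An isomorphism is a bijection between dart sets only, whereas \<open>relabel\<close>
  conjugates by a bijection of the whole type. Since \<open>D' - D\<close> and \<open>D - D'\<close>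
  have equal size, the first can be sent onto the second and everything outside \<open>D\<close> and
  \<open>D'\<close> left fixed.\<close>

lemma extend_bij_betw:
  fixes f :: "'a \<Rightarrow> 'a"
  assumes "finite D" "bij_betw f D D'"
  obtains g where "bij g" "\<And>x. x \<in> D \<Longrightarrow> g x = f x"
proof -
  have fD: "finite D'" using assms bij_betw_finite by blast
  have "card D = card D'" using assms(2) by (rule bij_betw_same_card)
  then have "card (D' - D) = card (D - D')"
    using assms(1) fD by (simp add: card_Diff_subset_Int Int_commute)
  then obtain h where h: "bij_betw h (D' - D) (D - D')"
    using finite_same_card_bij[of "D' - D" "D - D'"] assms(1) fD by auto
  let ?k = "\<lambda>x. if x \<in> D then f x else h x"
  let ?g = "\<lambda>x. if x \<in> D \<union> D' then ?k x else id x"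
  have "bij_betw ?k (D \<union> (D' - D)) (D' \<union> (D - D'))"
    by (rule bij_betw_disjoint_Un[OF assms(2) h]) auto
  then have k: "bij_betw ?k (D \<union> D') (D \<union> D')"
    by (simp add: Un_commute)
  have "bij_betw ?g ((D \<union> D') \<union> - (D \<union> D')) ((D \<union> D') \<union> - (D \<union> D'))"
    by (rule bij_betw_disjoint_Un[OF k bij_betw_id]) auto
  then have "bij ?g" by (simp only: Compl_partition)
  moreover have "?g x = f x" if "x \<in> D" for x using that by simp
  ultimately show ?thesis using that by blast
qed

text \<open>Equality of records also compares \<open>opp\<close> and \<open>nxt\<close> off the
  darts. There they are the identity, by \<open>permutes\<close>, and so are their
  conjugates.\<close>

lemma isomorphic_hmap_imp_relabel:
  fixes m m' :: "'d hmap"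
  assumes m: "planar_map m" "holes m = {}" and m': "planar_map m'" "holes m' = {}"
    and iso: "isomorphic_hmap m m'"
  obtains g where "bij g" "m' = relabel g m"
proof -
  obtain f where f: "hmap_iso f m m'" using iso by (auto simp: isomorphic_hmap_def)
  have "finite (darts m)" using m(1) by (simp add: planar_map_def)
  then obtain g where g: "bij g" "\<And>x. x \<in> darts m \<Longrightarrow> g x = f x"
    using extend_bij_betw f by (metis hmap_iso_def)
  have i: "inj g" using g(1) by (rule bij_is_inj)
  have d: "darts m' = g ` darts m"
    using f g(2) by (auto simp: hmap_iso_def bij_betw_def)
  have conj: "p' = g \<circ> p \<circ> inv g"
    if p: "p permutes darts m" "p' permutes darts m'" "\<And>x. x \<in> darts m \<Longrightarrow> f (p x) = p' (f x)"
    for p p'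
  proof
    fix x
    obtain y where x: "x = g y" using g(1) by (metis bij_pointE)
    show "p' x = (g \<circ> p \<circ> inv g) x"
    proof (cases "y \<in> darts m")
      case True
      then have "p y \<in> darts m" using p(1) by (simp add: permutes_in_image)
      then have "g (p y) = p' (g y)" using True p(3)[OF True] g(2) by simp
      then show ?thesis by (simp add: x i)
    next
      case False
      then have "x \<notin> darts m'" by (simp add: d x inj_image_mem_iff[OF i])
      then show ?thesis using p False by (simp add: permutes_not_in x i)
    qed
  qed
  have "opp m' = g \<circ> opp m \<circ> inv g" "nxt m' = g \<circ> nxt m \<circ> inv g"
    using m m' f by (auto intro!: conj simp: planar_map_def hmap_iso_def)
  moreover have "root m' = g (root m)"
    using f g(2) m by (simp add: hmap_iso_def planar_map_def)
  ultimately have "m' = relabel g m"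
    using d m(2) m'(2) by (intro hmap.equality) simp_all
  with g(1) show ?thesis by (rule that)
qed

section \<open>Equivariance of submaps, the right process and peeling\<close>

lemma map_sum_inv:
  assumes "bij f"
  shows "map_sum f f \<circ> map_sum (inv f) (inv f) = id"
    and "map_sum (inv f) (inv f) \<circ> map_sum f f = id"
proof -
  have "f \<circ> inv f = id" "inv f \<circ> f = id"
    using assms by (simp_all add: bij_is_surj bij_is_inj surj_iff[symmetric])
  then show "map_sum f f \<circ> map_sum (inv f) (inv f) = id"
    "map_sum (inv f) (inv f) \<circ> map_sum f f = id"
    by (simp_all add: map_sum.comp map_sum.id)
qed

lemma inv_map_sum: "bij f \<Longrightarrow> inv (map_sum f f) = map_sum (inv f) (inv f)"
  by (intro inv_unique_comp map_sum_inv)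

lemma bij_map_sum: "bij f \<Longrightarrow> bij (map_sum f f)"
  by (rule o_bij[OF map_sum_inv(2,1)])

context
  fixes f :: "'c \<Rightarrow> 'd" and m :: "'c hmap"
  assumes f: "bij f" and nxt: "bij (nxt m)"
begin

lemma inj_f: "inj f" using f by (rule bij_is_inj)

lemma inv_nxt_relabel: "inv (nxt (relabel f m)) (f x) = f (inv (nxt m) x)"
  using conj_inv[OF f nxt] by (simp add: inj_f)

lemma hole_nxt_relabel: "hole_nxt (relabel f m) (f ` G) (f d) = f (hole_nxt m G d)"
proof -
  have turn: "(\<lambda>x. inv (nxt (relabel f m)) (opp (relabel f m) x))
      = f \<circ> (\<lambda>x. inv (nxt m) (opp m x)) \<circ> inv f"
    using inv_nxt_relabel by (simp add: fun_eq_iff del: relabel_sel(3))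
  show ?thesis
    unfolding hole_nxt_def Let_def turn
    by (simp add: conj_funpow[OF inj_f] inj_f inj_image_mem_iff[OF inj_f])
qed

lemma submap_opp_relabel:
  "submap_opp (relabel f m) (f ` F) (f ` G) = map_sum f f \<circ> submap_opp m F G \<circ> inv (map_sum f f)"
proof
  fix x
  obtain y where "x = map_sum f f y" using bij_map_sum[OF f] by (metis bij_pointE)
  then show "submap_opp (relabel f m) (f ` F) (f ` G) x
      = (map_sum f f \<circ> submap_opp m F G \<circ> inv (map_sum f f)) x"
    by (cases y) (auto simp: submap_opp_def inv_map_sum[OF f] inj_f inj_image_mem_iff[OF inj_f]
        image_set_diff[OF inj_f, symmetric])
qed

lemma submap_nxt_relabel:
  "submap_nxt (relabel f m) (f ` F) (f ` G) = map_sum f f \<circ> submap_nxt m F G \<circ> inv (map_sum f f)"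
proof
  fix x
  obtain y where "x = map_sum f f y" using bij_map_sum[OF f] by (metis bij_pointE)
  then show "submap_nxt (relabel f m) (f ` F) (f ` G) x
      = (map_sum f f \<circ> submap_nxt m F G \<circ> inv (map_sum f f)) x"
    by (cases y) (auto simp: submap_nxt_def inv_map_sum[OF f] inj_f inj_image_mem_iff[OF inj_f]
        image_set_diff[OF inj_f, symmetric] hole_nxt_relabel)
qed

lemma submap_relabel:
  "submap (relabel f m) (f ` F) (f ` G) = relabel (map_sum f f) (submap m F G)"
proof (rule hmap.equality)
  have d: "f ` F - f ` G = f ` (F - G)" using inj_f by (simp add: image_set_diff)
  show "darts (submap (relabel f m) (f ` F) (f ` G)) = darts (relabel (map_sum f f) (submap m F G))"
    by (simp add: submap_def d image_Un image_image)
  have "orbit (submap_nxt (relabel f m) (f ` F) (f ` G)) (Inr (f x))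
      = map_sum f f ` orbit (submap_nxt m F G) (Inr x)" for x
    using conj_orbit[OF bij_is_inj[OF bij_map_sum[OF f]], of "submap_nxt m F G" "Inr x"]
    by (simp add: submap_nxt_relabel)
  then show "holes (submap (relabel f m) (f ` F) (f ` G)) = holes (relabel (map_sum f f) (submap m F G))"
    by (simp add: submap_def d image_image)
qed (simp_all add: submap_def submap_opp_relabel submap_nxt_relabel)

lemma right_state_relabel:
  "right_state (relabel f m) n = (f (fst (right_state m n)), f ` snd (right_state m n))"
proof (induction n)
  case (Suc n)
  obtain d V where dV: "right_state m n = (d, V)" by fastforce
  have p: "inv (nxt (relabel f m)) = f \<circ> inv (nxt m) \<circ> inv f"
    using conj_inv[OF f nxt] by simp
  show ?case
    using Suc.IH
    by (simp add: dV Let_def p conj_funpow[OF inj_f] inj_f inj_image_mem_iff[OF inj_f]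
        del: relabel_sel(3))
qed (simp add: inj_f)

lemma right_step_relabel: "right_step (relabel f m) i = f (right_step m i)"
  by (simp add: right_step_def right_state_relabel)

lemma root_face_relabel: "root_face (relabel f m) = f ` root_face m"
  by (simp add: root_face_def face_at_relabel[OF inj_f])

lemma right_face_relabel: "right_face (relabel f m) i = f ` right_face m i"
  by (cases i) (simp_all add: root_face_relabel right_step_relabel inj_f face_at_relabel[OF inj_f])

lemma right_submap_relabel: "right_submap (relabel f m) = relabel (map_sum f f) (right_submap m)"
proof -
  have E: "tau_E (relabel f m) = tau_E m"
    by (simp add: tau_E_def right_face_relabel root_face_relabel inj_image_eq_iff[OF inj_f])
  have S: "self_meeting_times (relabel f m) = self_meeting_times m"
    by (simp add: self_meeting_times_def E right_face_relabel inj_image_eq_iff[OF inj_f])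
  have I: "tau_I (relabel f m) = tau_I m" by (simp add: tau_I_def S)
  have R: "tau_R (relabel f m) = tau_R m"
    by (simp add: tau_R_def E I right_face_relabel inj_image_eq_iff[OF inj_f])
  have "cycle_times (relabel f m) = cycle_times m" "cycle_steps (relabel f m) = cycle_steps m"
    by (simp_all add: cycle_times_def cycle_steps_def S E I R)
  then show ?thesis
    unfolding right_submap_def submap_relabel[symmetric]
    by (simp add: right_face_relabel right_step_relabel image_UN inj_f)
qed

end

text \<open>
  Choosing \<open>Inr\<close> unconditionally keeps \<open>peel_state_relabel\<close> free of assumptions on \<open>A\<close>: only
  \<open>projr\<close> of the choice enters \<open>peel_state\<close>, and \<open>projr\<close> commutes with \<open>map_sum\<close> only on \<open>Inr\<close>.
\<close>

definition pull_back_algorithm ::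
    "('c \<Rightarrow> 'd) \<Rightarrow> (('d + 'd) hmap \<Rightarrow> 'd + 'd) \<Rightarrow> ('c + 'c) hmap \<Rightarrow> 'c + 'c" where
  "pull_back_algorithm f A e = Inr (inv f (projr (A (relabel (map_sum f f) e))))"

lemma peel_state_relabel:
  assumes f: "bij f" and nxt: "bij (nxt m)"
  shows "peel_state A (relabel f m) n =
    (f ` fst (peel_state (pull_back_algorithm f A) m n),
     f ` snd (peel_state (pull_back_algorithm f A) m n))"
proof (induction n)
  case 0
  then show ?case by (simp add: root_face_relabel[OF f nxt])
next
  case (Suc n)
  have i: "inj f" using f by (rule bij_is_inj)
  obtain F G where FG: "peel_state (pull_back_algorithm f A) m n = (F, G)" by fastforce
  define d where "d = projr (pull_back_algorithm f A (submap m F G))"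
  have d: "projr (A (submap (relabel f m) (f ` F) (f ` G))) = f d"
    using f by (simp add: d_def pull_back_algorithm_def submap_relabel[OF f nxt] bij_is_surj surj_f_inv_f)
  have h: "holes (submap (relabel f m) (f ` F) (f ` G)) = {} \<longleftrightarrow> holes (submap m F G) = {}"
    by (simp add: submap_relabel[OF f nxt])
  show ?case
    using Suc.IH
    by (simp add: FG h d d_def[symmetric] Let_def i inj_image_mem_iff[OF i] face_at_relabel[OF i] image_Un)
qed

lemma exploration_relabel:
  assumes "bij f" and "bij (nxt m)"
  shows "exploration A (relabel f m) n =
    relabel (map_sum f f) (exploration (pull_back_algorithm f A) m n)"
  unfolding exploration_def peel_state_relabel[OF assms]
  by (simp add: submap_relabel[OF assms] split: prod.split)

text \<open>Invariance of \<open>A\<close> under the isomorphism \<open>map_sum f f\<close> moves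
  the choice by \<open>f\<close>, and the pull-back undoes this. A peeling algorithm is constrained
  only on quadrangulations with at least one hole. That holes lie in \<open>range Inr\<close> gives
  the choice the form \<open>Inr x\<close>, which \<open>pull_back_algorithm\<close> always
  returns.\<close>

lemma pull_back_algorithm_eq:
  fixes f :: "'d \<Rightarrow> 'd"
  assumes f: "bij f" and A: "peeling_algorithm A"
    and e: "quadrangulation_with_holes e" "holes e \<noteq> {}" "\<Union>(holes e) \<subseteq> range Inr"
  shows "pull_back_algorithm f A e = A e"
proof -
  let ?s = "map_sum f f"
  have "A e \<in> \<Union>(holes e)" using A e(1,2) by (simp add: peeling_algorithm_def)
  then obtain x where x: "A e = Inr x" using e(3) by auto
  have "A (relabel ?s e) = ?s (A e)"
    using A e(1,2) quadrangulation_with_holes_relabel[OF bij_map_sum[OF f] e(1)]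
      hmap_iso_relabel[OF bij_is_inj[OF bij_map_sum[OF f]], of e]
    unfolding peeling_algorithm_def by blast
  then show ?thesis using f by (simp add: pull_back_algorithm_def x bij_is_inj)
qed

lemma isomorphic_right_submap_relabelD:
  assumes f: "bij f" and nxt: "bij (nxt m)"
    and iso: "isomorphic_hmap (right_submap (relabel f m)) (exploration A (relabel f m) n)"
  shows "isomorphic_hmap (right_submap m) (exploration (pull_back_algorithm f A) m n)"
  using iso unfolding right_submap_relabel[OF f nxt] exploration_relabel[OF f nxt]
  by (rule isomorphic_hmap_relabel_cancel[OF bij_map_sum[OF f]])

section \<open>Two maps with two inner faces\<close>

text \<open>Arguments beyond the list are fixed because \<open>permutes\<close> demands the identity
  outside the darts.\<close>

definition table :: "nat list \<Rightarrow> nat \<Rightarrow> nat" where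
  "table xs x = (if x < length xs then xs ! x else x)"

text \<open>
  The root face has the sides 0 and 1; across them lie the faces with sides 2, 3, 4, 5 and
  6, 7, 8, 9. Both gluings identify 0 with 2 and 1 with 6. In \<open>gluing1\<close> the right process leaves
  the first face through 5 and returns at once through 4, so only 3 (glued to 7) survives the removal
  of the loop. In \<open>gluing2\<close> it passes from 5 to 9, and the loop to be removed crosses 8 and 7. The
  further edges of the two remaining sets of glued sides are disjoint.
\<close>

definition two_face_map :: "nat list \<Rightarrow> nat hmap" where
  "two_face_map os =
     \<lparr> darts = {..<10}, opp = table os, nxt = table [1, 0, 3, 4, 5, 2, 7, 8, 9, 6],
       root = 0, holes = {} \<rparr>"

definition gluing1 :: "nat list" where
  "gluing1 = [2, 6, 0, 7, 5, 4, 1, 3, 9, 8]"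

definition gluing2 :: "nat list" where
  "gluing2 = [2, 6, 0, 4, 3, 9, 1, 8, 7, 5]"

lemma two_face_map_sel [simp]:
  "darts (two_face_map os) = {..<10}" "opp (two_face_map os) = table os"
  "nxt (two_face_map os) = table [1, 0, 3, 4, 5, 2, 7, 8, 9, 6]"
  "root (two_face_map os) = 0" "holes (two_face_map os) = {}"
  by (simp_all add: two_face_map_def)

lemma lessThan_10: "{..<10::nat} = {0, 1, 2, 3, 4, 5, 6, 7, 8, 9}"
  by (auto simp: numeral_eq_Suc less_Suc_eq)

lemma inv_nxt [simp]:
  "inv (table [1, 0, 3, 4, 5, 2, 7, 8, 9, 6]) = table [1, 0, 5, 2, 3, 4, 9, 6, 7, 8]"
proof (rule inv_unique_comp; rule ext)
  fix x :: nat
  consider "x \<ge> 10" | "x \<in> {0, 1, 2, 3, 4, 5, 6, 7, 8, 9}"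
    unfolding lessThan_10[symmetric] by fastforce
  note c = this
  show "(table [1, 0, 3, 4, 5, 2, 7, 8, 9, 6] \<circ> table [1, 0, 5, 2, 3, 4, 9, 6, 7, 8]) x = id x"
    using c by cases (auto simp: table_def)
  show "(table [1, 0, 5, 2, 3, 4, 9, 6, 7, 8] \<circ> table [1, 0, 3, 4, 5, 2, 7, 8, 9, 6]) x = id x"
    using c by cases (auto simp: table_def)
qed

text \<open>Simplification may rewrite the entry \<open>1\<close> to \<open>Suc 0\<close>, so the
  rule is provided for both forms of the list.\<close>

lemmas inv_nxt_Suc [simp] = inv_nxt[unfolded One_nat_def]

lemma planar_two_face_map:
  assumes "os \<in> {gluing1, gluing2}"
  shows "planar_map (two_face_map os)"
proof -
  consider "os = gluing1" | "os = gluing2" using assms by blast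
  then show ?thesis
  proof cases
    case 1
    \<comment> \<open>Both cases have four vertices, three faces and five edges. The walks end at 1,
      from where \<open>nxt\<close> leads back to their start 0.\<close>
    show ?thesis
      by (rule planar_mapI[where fss = "[[0, 1], [2, 3, 4, 5], [6, 7, 8, 9]]"
            and vss = "[[0, 3, 8, 6], [1, 7, 4, 2], [5], [9]]"
            and ess = "[[0, 2], [1, 6], [4, 5], [3, 7], [8, 9]]"
            and ws = "[0, 2, 3, 4, 5, 2, 3, 7, 8, 9, 6, 1]"])
        (auto simp: table_def 1 gluing1_def lessThan_10)
  next
    case 2
    show ?thesis
      by (rule planar_mapI[where fss = "[[0, 1], [2, 3, 4, 5], [6, 7, 8, 9]]"
            and vss = "[[0, 3, 5, 6], [1, 7, 9, 2], [4], [8]]"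
            and ess = "[[0, 2], [1, 6], [5, 9], [7, 8], [3, 4]]"
            and ws = "[0, 2, 3, 4, 5, 9, 6, 7, 8, 9, 6, 1]"])
        (auto simp: table_def 2 gluing2_def lessThan_10)
  qed
qed

lemma face_at_two_face_map:
  "x \<in> {0, 1} \<Longrightarrow> face_at (two_face_map os) x = {0, 1}"
  "x \<in> {2, 3, 4, 5} \<Longrightarrow> face_at (two_face_map os) x = {2, 3, 4, 5}"
  "x \<in> {6, 7, 8, 9} \<Longrightarrow> face_at (two_face_map os) x = {6, 7, 8, 9}"
  using orbit_cycle_list[of "nxt (two_face_map os)" "[0, 1]"]
    orbit_cycle_list[of "nxt (two_face_map os)" "[2, 3, 4, 5]"]
    orbit_cycle_list[of "nxt (two_face_map os)" "[6, 7, 8, 9]"]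
  by (auto simp: face_at_def table_def)

lemma root_face_two_face_map: "root_face (two_face_map os) = {0, 1}"
  by (simp add: root_face_def face_at_two_face_map)

lemma quadrangulation_two_face_map:
  assumes "os \<in> {gluing1, gluing2}"
  shows "quadrangulation 1 (two_face_map os)"
proof -
  have "faces (two_face_map os) = {{0, 1}, {2, 3, 4, 5}, {6, 7, 8, 9}}"
    by (simp add: faces_def lessThan_10 face_at_two_face_map insert_commute)
  then have "faces (two_face_map os) - {root_face (two_face_map os)}
      \<subseteq> {{2, 3, 4, 5}, {6, 7, 8, 9}}"
    unfolding root_face_two_face_map by blast
  moreover have "\<forall>f\<in>{{2, 3, 4, 5}, {6, 7, 8, 9 :: nat}}. card f = 4" by simp
  ultimately have "\<forall>f\<in>faces (two_face_map os) - {root_face (two_face_map os)}. card f = 4"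
    by blast
  then show ?thesis
    using planar_two_face_map[OF assms]
    by (simp add: quadrangulation_def) (simp add: root_face_two_face_map)
qed

section \<open>Explored maps shared by the two gluings\<close>

lemma hole_nxt_eq:
  assumes "0 < k" "((\<lambda>x. inv (nxt m) (opp m x)) ^^ k) (opp m d) = y" "y \<notin> G"
    and "\<And>j. 0 < j \<Longrightarrow> j < k \<Longrightarrow> ((\<lambda>x. inv (nxt m) (opp m x)) ^^ j) (opp m d) \<in> G"
  shows "hole_nxt m G d = y"
proof -
  have "(LEAST k. 0 < k \<and> ((\<lambda>x. inv (nxt m) (opp m x)) ^^ k) (opp m d) \<notin> G) = k"
    using assms by (intro Least_equality) (auto simp: not_less[symmetric])
  then show ?thesis using assms(2) by (simp add: hole_nxt_def)
qed

text \<open>The first turn leads to the predecessor of \<open>d\<close>, and each further one passes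
  a glued side. Passing two is enough for the four states below: with both root edges glued, the
  contour after 3 passes the sides 2 and 1 and arrives at 9.\<close>

lemma hole_nxt_1:
  assumes "opp m (opp m d) = d" "inv (nxt m) d \<notin> G"
  shows "hole_nxt m G d = inv (nxt m) d"
  by (rule hole_nxt_eq[where k = 1]) (use assms in auto)

lemma hole_nxt_2:
  assumes "opp m (opp m d) = d" "inv (nxt m) d \<in> G" "inv (nxt m) (opp m (inv (nxt m) d)) \<notin> G"
  shows "hole_nxt m G d = inv (nxt m) (opp m (inv (nxt m) d))"
  by (rule hole_nxt_eq[where k = 2]) (use assms in \<open>auto simp: less_Suc_eq numeral_2_eq_2\<close>)

lemma hole_nxt_3:
  assumes "opp m (opp m d) = d" "inv (nxt m) d \<in> G" "inv (nxt m) (opp m (inv (nxt m) d)) \<in> G"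
    "inv (nxt m) (opp m (inv (nxt m) (opp m (inv (nxt m) d)))) \<notin> G"
  shows "hole_nxt m G d = inv (nxt m) (opp m (inv (nxt m) (opp m (inv (nxt m) d))))"
  by (rule hole_nxt_eq[where k = 3]) (use assms in \<open>auto simp: less_Suc_eq numeral_3_eq_3\<close>)

lemmas submap_eval = submap_def submap_opp_def submap_nxt_def hole_nxt_1 hole_nxt_2 hole_nxt_3
  table_def gluing1_def gluing2_def

text \<open>In \<open>hole_nxt\<close> the first turn cancels \<open>opp\<close> against
  \<open>opp\<close>, and further turns apply it only to glued darts. These are among 0, 1, 2, 6,
  where the two gluings agree. The explored map thus says nothing about the matching of the
  remaining inner sides.\<close>

lemma submap_gluing_cong:
  assumes "(F, G) \<in> {({0, 1}, {}), ({0, 1, 2, 3, 4, 5}, {0, 2}), ({0, 1, 6, 7, 8, 9}, {1, 6}),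
    ({0, 1, 2, 3, 4, 5, 6, 7, 8, 9}, {0, 1, 2, 6})}"
  shows "submap (two_face_map gluing1) F G = submap (two_face_map gluing2) F G"
proof -
  have "submap_opp (two_face_map gluing1) F G = submap_opp (two_face_map gluing2) F G"
  proof
    fix x show "submap_opp (two_face_map gluing1) F G x = submap_opp (two_face_map gluing2) F G x"
      using assms by (cases x) (auto simp: submap_opp_def table_def gluing1_def gluing2_def)
  qed
  moreover have "hole_nxt (two_face_map gluing1) G d = hole_nxt (two_face_map gluing2) G d"
    if "d \<in> F - G" for d
    using that assms by (auto simp: submap_eval)
  then have "submap_nxt (two_face_map gluing1) F G = submap_nxt (two_face_map gluing2) F G"
    by (auto simp: fun_eq_iff submap_nxt_def split: sum.split)
  ultimately show ?thesis by (simp add: submap_def)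
qed

text \<open>Both conditions on a peeling algorithm concern such maps only, so its choices in these
  states are controlled through this check. By \<open>submap_gluing_cong\<close> it covers
  \<open>gluing2\<close> as well.\<close>

lemma quadrangulation_with_holes_submap:
  "quadrangulation_with_holes (submap (two_face_map gluing1) {0, 1} {})"
  "quadrangulation_with_holes (submap (two_face_map gluing1) {0, 1, 2, 3, 4, 5} {0, 2})"
  "quadrangulation_with_holes (submap (two_face_map gluing1) {0, 1, 6, 7, 8, 9} {1, 6})"
  "quadrangulation_with_holes
     (submap (two_face_map gluing1) {0, 1, 2, 3, 4, 5, 6, 7, 8, 9} {0, 1, 2, 6})"
proof -
  let ?r = "[Inl 0, Inl 1]"
  note eval = submap_eval insert_Diff_if insert_commute face_at_def
  let ?e = "submap (two_face_map gluing1) {0, 1} {}"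
  let ?h = "[Inr 0, Inr 1]"
  let ?q = "[]"
  let ?v = "[[Inl 0, Inr 1], [Inl 1, Inr 0]]"
  let ?ed = "[[Inl 0, Inr 0], [Inl 1, Inr 1]]"
  let ?w = "[Inl 0, Inl 1, Inr 1, Inr 0]"
  have "planar_map ?e"
    by (rule planar_mapI[where fss = "?r # ?h # ?q" and vss = ?v and ess = ?ed and ws = ?w])
      (simp_all add: eval split: sum.splits)
  then show "quadrangulation_with_holes ?e"
    by (rule quadrangulation_with_holesI[where rs = ?r and hs = ?h and qss = ?q and vss = ?v])
      (simp_all add: eval)
next
  let ?r = "[Inl 0, Inl 1]"
  note eval = submap_eval insert_Diff_if insert_commute face_at_def
  let ?e = "submap (two_face_map gluing1) {0, 1, 2, 3, 4, 5} {0, 2}"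
  let ?h = "[Inr 1, Inr 5, Inr 4, Inr 3]"
  let ?q = "[[Inl 2, Inl 3, Inl 4, Inl 5]]"
  let ?v = "[[Inl 0, Inl 3, Inr 1], [Inl 1, Inr 5, Inl 2], [Inl 4, Inr 3], [Inl 5, Inr 4]]"
  let ?ed = "[[Inl 0, Inl 2], [Inl 1, Inr 1], [Inl 3, Inr 3], [Inl 4, Inr 4], [Inl 5, Inr 5]]"
  let ?w = "[Inl 0, Inl 1, Inr 1, Inr 5, Inr 4, Inr 3, Inl 3, Inl 4, Inl 5, Inl 2]"
  have "planar_map ?e"
    by (rule planar_mapI[where fss = "?r # ?h # ?q" and vss = ?v and ess = ?ed and ws = ?w])
      (simp_all add: eval split: sum.splits)
  then show "quadrangulation_with_holes ?e"
    by (rule quadrangulation_with_holesI[where rs = ?r and hs = ?h and qss = ?q and vss = ?v])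
      (simp_all add: eval)
next
  let ?r = "[Inl 0, Inl 1]"
  note eval = submap_eval insert_Diff_if insert_commute face_at_def
  let ?e = "submap (two_face_map gluing1) {0, 1, 6, 7, 8, 9} {1, 6}"
  let ?h = "[Inr 0, Inr 9, Inr 8, Inr 7]"
  let ?q = "[[Inl 6, Inl 7, Inl 8, Inl 9]]"
  let ?v = "[[Inl 1, Inl 7, Inr 0], [Inl 0, Inr 9, Inl 6], [Inl 8, Inr 7], [Inl 9, Inr 8]]"
  let ?ed = "[[Inl 1, Inl 6], [Inl 0, Inr 0], [Inl 7, Inr 7], [Inl 8, Inr 8], [Inl 9, Inr 9]]"
  let ?w = "[Inl 1, Inl 0, Inr 0, Inr 9, Inr 8, Inr 7, Inl 7, Inl 8, Inl 9, Inl 6]"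
  have "planar_map ?e"
    by (rule planar_mapI[where fss = "?r # ?h # ?q" and vss = ?v and ess = ?ed and ws = ?w])
      (simp_all add: eval split: sum.splits)
  then show "quadrangulation_with_holes ?e"
    by (rule quadrangulation_with_holesI[where rs = ?r and hs = ?h and qss = ?q and vss = ?v])
      (simp_all add: eval)
next
  let ?r = "[Inl 0, Inl 1]"
  note eval = submap_eval insert_Diff_if insert_commute face_at_def
  let ?e = "submap (two_face_map gluing1) {0, 1, 2, 3, 4, 5, 6, 7, 8, 9} {0, 1, 2, 6}"
  let ?h = "[Inr 3, Inr 9, Inr 8, Inr 7, Inr 5, Inr 4]"
  let ?q = "[[Inl 2, Inl 3, Inl 4, Inl 5], [Inl 6, Inl 7, Inl 8, Inl 9]]"
  let ?v = "[[Inl 0, Inl 3, Inr 9, Inl 6], [Inl 1, Inl 7, Inr 5, Inl 2], [Inl 4, Inr 3],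
    [Inl 5, Inr 4], [Inl 8, Inr 7], [Inl 9, Inr 8]]"
  let ?ed = "[[Inl 0, Inl 2], [Inl 1, Inl 6], [Inl 3, Inr 3], [Inl 4, Inr 4],
    [Inl 5, Inr 5], [Inl 7, Inr 7], [Inl 8, Inr 8], [Inl 9, Inr 9]]"
  let ?w = "[Inl 0, Inl 1, Inl 6, Inl 7, Inr 7, Inr 5, Inr 4, Inr 3, Inr 9, Inr 8, Inl 8,
    Inl 9, Inl 6, Inl 1, Inl 0, Inl 2, Inl 3, Inl 4, Inl 5, Inl 2]"
  have "planar_map ?e"
    by (rule planar_mapI[where fss = "?r # ?h # ?q" and vss = ?v and ess = ?ed and ws = ?w])
      (simp_all add: eval split: sum.splits)
  then show "quadrangulation_with_holes ?e"
    by (rule quadrangulation_with_holesI[where rs = ?r and hs = ?h and qss = ?q and vss = ?v])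
      (simp_all add: eval)
qed

section \<open>The right process on the two maps\<close>

lemma face_sets_distinct:
  "{2, 3, 4, 5} \<noteq> {6, 7, 8, 9::nat}" "{0, 1} \<noteq> {6, 7, 8, 9::nat}" "{2, 3, 4, 5} \<noteq> {0, 1::nat}"
proof -
  have "(2::nat) \<in> {2, 3, 4, 5}" "2 \<notin> {6, 7, 8, 9::nat}" "2 \<notin> {0, 1::nat}"
    "(0::nat) \<in> {0, 1}" "0 \<notin> {6, 7, 8, 9::nat}"
    by simp_all
  then show "{2, 3, 4, 5} \<noteq> {6, 7, 8, 9::nat}" "{0, 1} \<noteq> {6, 7, 8, 9::nat}"
    "{2, 3, 4, 5} \<noteq> {0, 1::nat}"
    by metis+
qed

text \<open>Index 0 in the \<open>LEAST\<close> is the side of entrance, which has just been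
  crossed. In both maps the side preceding it is still free at each step computed, so the least
  index is always 1.\<close>

lemma right_state_Suc_pred:
  assumes "right_state m n = (d, V)" "opp m d \<in> V" "inv (nxt m) (opp m d) \<notin> V"
    and "d' = inv (nxt m) (opp m d)"
  shows "right_state m (Suc n) = (d', insert d' (insert (opp m d') V))"
proof -
  have "(LEAST k. (inv (nxt m) ^^ k) (opp m d) \<notin> V) = Suc 0"
    by (rule Least_equality) (use assms in \<open>auto simp: not_less_eq_eq[symmetric] intro: Suc_leI gr0I\<close>)
  then show ?thesis by (simp add: assms(1) Let_def assms(4))
qed

lemma right_submap_gluing1:
  "right_submap (two_face_map gluing1) = submap (two_face_map gluing1) {..<10} {0, 1, 2, 6, 3, 7}"
proof -
  let ?m = "two_face_map gluing1"
  have s0: "right_state ?m 0 = (0, {0, 2})"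
    by (simp add: table_def gluing1_def)
  have s1: "right_state ?m (Suc 0) = (5, {5, 4, 0, 2})"
    using right_state_Suc_pred[OF s0 _ _ refl] by (simp add: table_def gluing1_def)
  have s2: "right_state ?m (Suc (Suc 0)) = (3, {3, 7, 5, 4, 0, 2})"
    using right_state_Suc_pred[OF s1 _ _ refl] by (simp add: table_def gluing1_def)
  have s3: "right_state ?m (Suc (Suc (Suc 0))) = (6, {6, 1, 3, 7, 5, 4, 0, 2})"
    using right_state_Suc_pred[OF s2 _ _ refl] by (simp add: table_def gluing1_def)
  have steps: "right_step ?m 0 = 0" "right_step ?m 1 = 5" "right_step ?m 2 = 3" "right_step ?m 3 = 6"
    using s0 s1 s2 s3 by (simp_all add: right_step_def numeral_2_eq_2 numeral_3_eq_3)
  have faces: "right_face ?m 0 = {0, 1}" "right_face ?m (Suc 0) = {2, 3, 4, 5}"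
    "right_face ?m 2 = {2, 3, 4, 5}" "right_face ?m 3 = {6, 7, 8, 9}" "right_face ?m 4 = {0, 1}"
    using right_face.simps(2)[of ?m 0] right_face.simps(2)[of ?m 1, unfolded Suc_1]
      right_face.simps(2)[of ?m 2] right_face.simps(2)[of ?m 3] steps
    by (simp_all add: root_face_two_face_map table_def gluing1_def face_at_two_face_map)
  have "tau_E ?m = (LEAST i. 1 \<le> i \<and> right_face ?m i = root_face ?m)"
    by (simp add: tau_E_def Inf_nat_def)
  also have "\<dots> = 4"
  proof (rule Least_equality)
    fix i assume i: "1 \<le> i \<and> right_face ?m i = root_face ?m"
    show "4 \<le> i"
    proof (rule ccontr)
      assume "\<not> 4 \<le> i"
      then have "i \<in> {Suc 0, 2, 3}" using i by auto
      then show False using i faces by (auto simp: root_face_two_face_map)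
    qed
  qed (simp add: faces root_face_two_face_map)
  finally have E: "tau_E ?m = 4" .
  \<comment> \<open>Time 0 is excluded, so the return to the root face at time 4 is not a
    self-meeting.\<close>
  have four: "{1..4} = {Suc 0, 2, 3, 4}" by auto
  have ne: "{2, 3, 4, 5} \<noteq> {6, 7, 8, 9::nat}" "{0, 1} \<noteq> {6, 7, 8, 9::nat}" "{2, 3, 4, 5} \<noteq> {0, 1::nat}"
    by (rule face_sets_distinct)+
  have "self_meeting_times ?m = {i \<in> {Suc 0, 2, 3, 4}. \<exists>j\<in>{Suc 0, 2, 3, 4}. j \<noteq> i \<and> right_face ?m i = right_face ?m j}"
    unfolding self_meeting_times_def E four ..
  also have "\<dots> = {Suc 0, 2}"
  proof (rule set_eqI)
    fix i :: nat
    show "i \<in> {i \<in> {Suc 0, 2, 3, 4}. \<exists>j\<in>{Suc 0, 2, 3, 4}. j \<noteq> i \<and> right_face ?m i = right_face ?m j} \<longleftrightarrow> i \<in> {Suc 0, 2}"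
      by (cases "i = Suc 0"; cases "i = 2"; cases "i = 3"; cases "i = 4")
        (simp_all add: faces ne[unfolded One_nat_def] ne[unfolded One_nat_def, symmetric]
          del: right_face.simps)
  qed
  finally have S: "self_meeting_times ?m = {Suc 0, 2}" .
  have I: "tau_I ?m = Suc 0"
    unfolding tau_I_def S by (simp add: cInf_insert inf_nat_def)
  have "{i. i \<le> tau_E ?m \<and> right_face ?m i = right_face ?m (tau_I ?m)}
     = {i \<in> {0, Suc 0, 2, 3, 4}. right_face ?m i = {2, 3, 4, 5}}"
    unfolding E I faces by auto
  also have "\<dots> = {Suc 0, 2}"
  proof (rule set_eqI)
    fix i :: nat
    show "i \<in> {i \<in> {0, Suc 0, 2, 3, 4}. right_face ?m i = {2, 3, 4, 5}} \<longleftrightarrow> i \<in> {Suc 0, 2}"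
      by (cases "i = 0"; cases "i = Suc 0"; cases "i = 2"; cases "i = 3"; cases "i = 4")
        (simp_all add: faces ne[unfolded One_nat_def] ne[unfolded One_nat_def, symmetric]
          del: right_face.simps)
  qed
  finally have R: "tau_R ?m = 2"
    unfolding tau_R_def by (simp add: cSup_insert sup_nat_def)
  \<comment> \<open>The step at time 1, from 5 to 4, is cut out. Both its end times 1 and 2 are
    kept, so every face stays revealed.\<close>
  have "cycle_times ?m = {0, Suc 0, 2, 3, 4}" "cycle_steps ?m = {0, 2, 3}"
    unfolding cycle_times_def cycle_steps_def S I R E by auto
  then have "(\<Union>i\<in>cycle_times ?m. right_face ?m i) = {..<10}"
    "(\<Union>i\<in>cycle_steps ?m. {right_step ?m i, opp ?m (right_step ?m i)}) = {0, 1, 2, 6, 3, 7}"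
    using steps
    by (simp_all add: faces lessThan_10 insert_commute del: right_face.simps)
      (simp add: table_def gluing1_def insert_commute)
  then show ?thesis
    unfolding right_submap_def by simp
qed

lemma right_submap_gluing2:
  "right_submap (two_face_map gluing2) = submap (two_face_map gluing2) {..<10} {0, 1, 2, 6, 5, 9}"
proof -
  let ?m = "two_face_map gluing2"
  have s0: "right_state ?m 0 = (0, {0, 2})"
    by (simp add: table_def gluing2_def)
  have s1: "right_state ?m (Suc 0) = (5, {5, 9, 0, 2})"
    using right_state_Suc_pred[OF s0 _ _ refl] by (simp add: table_def gluing2_def)
  have s2: "right_state ?m (Suc (Suc 0)) = (8, {8, 7, 5, 9, 0, 2})"
    using right_state_Suc_pred[OF s1 _ _ refl] by (simp add: table_def gluing2_def)
  have s3: "right_state ?m (Suc (Suc (Suc 0))) = (6, {6, 1, 8, 7, 5, 9, 0, 2})"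
    using right_state_Suc_pred[OF s2 _ _ refl] by (simp add: table_def gluing2_def)
  have steps: "right_step ?m 0 = 0" "right_step ?m 1 = 5" "right_step ?m 2 = 8" "right_step ?m 3 = 6"
    using s0 s1 s2 s3 by (simp_all add: right_step_def numeral_2_eq_2 numeral_3_eq_3)
  have faces: "right_face ?m 0 = {0, 1}" "right_face ?m (Suc 0) = {2, 3, 4, 5}"
    "right_face ?m 2 = {6, 7, 8, 9}" "right_face ?m 3 = {6, 7, 8, 9}" "right_face ?m 4 = {0, 1}"
    using right_face.simps(2)[of ?m 0] right_face.simps(2)[of ?m 1, unfolded Suc_1]
      right_face.simps(2)[of ?m 2] right_face.simps(2)[of ?m 3] steps
    by (simp_all add: root_face_two_face_map table_def gluing2_def face_at_two_face_map)
  have "tau_E ?m = (LEAST i. 1 \<le> i \<and> right_face ?m i = root_face ?m)"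
    by (simp add: tau_E_def Inf_nat_def)
  also have "\<dots> = 4"
  proof (rule Least_equality)
    fix i assume i: "1 \<le> i \<and> right_face ?m i = root_face ?m"
    show "4 \<le> i"
    proof (rule ccontr)
      assume "\<not> 4 \<le> i"
      then have "i \<in> {Suc 0, 2, 3}" using i by auto
      then show False using i faces by (auto simp: root_face_two_face_map)
    qed
  qed (simp add: faces root_face_two_face_map)
  finally have E: "tau_E ?m = 4" .
  have four: "{1..4} = {Suc 0, 2, 3, 4}" by auto
  have ne: "{2, 3, 4, 5} \<noteq> {6, 7, 8, 9::nat}" "{0, 1} \<noteq> {6, 7, 8, 9::nat}" "{2, 3, 4, 5} \<noteq> {0, 1::nat}"
    by (rule face_sets_distinct)+
  have "self_meeting_times ?m = {i \<in> {Suc 0, 2, 3, 4}. \<exists>j\<in>{Suc 0, 2, 3, 4}. j \<noteq> i \<and> right_face ?m i = right_face ?m j}"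
    unfolding self_meeting_times_def E four ..
  also have "\<dots> = {2, 3}"
  proof (rule set_eqI)
    fix i :: nat
    show "i \<in> {i \<in> {Suc 0, 2, 3, 4}. \<exists>j\<in>{Suc 0, 2, 3, 4}. j \<noteq> i \<and> right_face ?m i = right_face ?m j} \<longleftrightarrow> i \<in> {2, 3}"
      by (cases "i = Suc 0"; cases "i = 2"; cases "i = 3"; cases "i = 4")
        (simp_all add: faces ne[unfolded One_nat_def] ne[unfolded One_nat_def, symmetric]
          del: right_face.simps)
  qed
  finally have S: "self_meeting_times ?m = {2, 3}" .
  have I: "tau_I ?m = 2"
    unfolding tau_I_def S by (simp add: cInf_insert inf_nat_def)
  have "{i. i \<le> tau_E ?m \<and> right_face ?m i = right_face ?m (tau_I ?m)}
     = {i \<in> {0, Suc 0, 2, 3, 4}. right_face ?m i = {6, 7, 8, 9}}"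
    unfolding E I faces by auto
  also have "\<dots> = {2, 3}"
  proof (rule set_eqI)
    fix i :: nat
    show "i \<in> {i \<in> {0, Suc 0, 2, 3, 4}. right_face ?m i = {6, 7, 8, 9}} \<longleftrightarrow> i \<in> {2, 3}"
      by (cases "i = 0"; cases "i = Suc 0"; cases "i = 2"; cases "i = 3"; cases "i = 4")
        (simp_all add: faces ne[unfolded One_nat_def] ne[unfolded One_nat_def, symmetric]
          del: right_face.simps)
  qed
  finally have R: "tau_R ?m = 3"
    unfolding tau_R_def by (simp add: cSup_insert sup_nat_def)
  \<comment> \<open>Here it is the step at time 2, from 8 to 7, that is cut out.\<close>
  have "cycle_times ?m = {0, Suc 0, 2, 3, 4}" "cycle_steps ?m = {0, Suc 0, 3}"
    unfolding cycle_times_def cycle_steps_def S I R E by auto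
  then have "(\<Union>i\<in>cycle_times ?m. right_face ?m i) = {..<10}"
    "(\<Union>i\<in>cycle_steps ?m. {right_step ?m i, opp ?m (right_step ?m i)}) = {0, 1, 2, 6, 5, 9}"
    using steps
    by (simp_all add: faces lessThan_10 insert_commute del: right_face.simps)
      (simp add: table_def gluing2_def insert_commute)
  then show ?thesis
    unfolding right_submap_def by simp
qed

section \<open>Wrongly glued edges\<close>

lemma peel_state_mono:
  assumes "k \<le> n"
  shows "fst (peel_state A m k) \<subseteq> fst (peel_state A m n) \<and>
    snd (peel_state A m k) \<subseteq> snd (peel_state A m n)"
  using assms
proof (induction n rule: dec_induct)
  case (step n)
  have "fst (peel_state A m n) \<subseteq> fst (peel_state A m (Suc n)) \<and>
      snd (peel_state A m n) \<subseteq> snd (peel_state A m (Suc n))"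
    by (auto simp: Let_def split: prod.split)
  then show ?case using step.IH by blast
qed simp

text \<open>Two submaps of one map are compared through their common labels. Being fixed by an
  isomorphism spreads along the contour of a face revealed in both and, in
  \<open>submap_iso_opp\<close>, across an edge glued in both.\<close>

lemma submap_iso_nxt:
  assumes "hmap_iso h (submap m F G) (submap m F' G')" "h (Inl d) = Inl d" "d \<in> F" "d \<in> F'"
  shows "h (Inl (nxt m d)) = Inl (nxt m d)"
proof -
  have "Inl d \<in> darts (submap m F G)" using assms(3) by (simp add: submap_def)
  then have "h (nxt (submap m F G) (Inl d)) = nxt (submap m F' G') (h (Inl d))"
    using assms(1) by (simp add: hmap_iso_def)
  then show ?thesis using assms(2-4) by (simp add: submap_def submap_nxt_def)
qed

lemma submap_iso_opp:
  assumes "hmap_iso h (submap m F G) (submap m F' G')" "h (Inl d) = Inl d" "d \<in> F" "d \<in> G" "d \<in> G'"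
  shows "h (Inl (opp m d)) = Inl (opp m d)"
proof -
  have "Inl d \<in> darts (submap m F G)" using assms(3) by (simp add: submap_def)
  then have "h (opp (submap m F G) (Inl d)) = opp (submap m F' G') (h (Inl d))"
    using assms(1) by (simp add: hmap_iso_def)
  then show ?thesis using assms(2-5) by (simp add: submap_def submap_opp_def)
qed

text \<open>If the edge were glued only in the second submap, \<open>h\<close> would send the hole
  side \<open>Inr d\<close> to \<open>Inl (opp m d)\<close>, which is already the image of
  \<open>Inl (opp m d)\<close>. This contradicts injectivity.\<close>

lemma submap_iso_glued:
  assumes h: "hmap_iso h (submap m F G) (submap m F' G')"
    and d: "h (Inl d) = Inl d" "h (Inl (opp m d)) = Inl (opp m d)" "d \<in> F" "opp m d \<in> F" "d \<in> G'"
  shows "d \<in> G"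
proof (rule ccontr)
  assume G: "d \<notin> G"
  have i: "inj_on h (darts (submap m F G))" using h by (simp add: hmap_iso_def bij_betw_def)
  have "Inl d \<in> darts (submap m F G)" using d by (simp add: submap_def)
  then have "h (opp (submap m F G) (Inl d)) = opp (submap m F' G') (h (Inl d))"
    using h by (simp add: hmap_iso_def)
  then have "h (Inr d) = h (Inl (opp m d))"
    using d G by (simp add: submap_def submap_opp_def)
  moreover have "Inr d \<in> darts (submap m F G)" "Inl (opp m d) \<in> darts (submap m F G)"
    using d G by (auto simp: submap_def)
  ultimately show False using inj_onD[OF i] by blast
qed

lemma card_darts_submap:
  fixes m :: "'a hmap"
  assumes "finite F"
  shows "card (darts (submap m F G)) = card F + card (F - G)"
proof -
  have "card (Inl ` F \<union> Inr ` (F - G)) = card (Inl ` F :: ('a + 'a) set) + card (Inr ` (F - G) :: ('a + 'a) set)"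
    using assms by (intro card_Un_disjoint) auto
  then show ?thesis by (simp add: submap_def card_image)
qed

lemma isomorphic_submap_card:
  assumes "isomorphic_hmap (submap m F G) (submap m F' G')" "finite F" "finite F'"
  shows "card F + card (F - G) = card F' + card (F' - G')"
  using assms card_darts_submap[of F m G] card_darts_submap[of F' m G']
  by (metis isomorphic_hmap_def hmap_iso_def bij_betw_same_card)

text \<open>An edge that is reachable from the root in both submaps is glued in both or in neither.\<close>

lemma wrong_gluing_not_isomorphic:
  assumes m: "m = two_face_map os" "os \<in> {gluing1, gluing2}"
    and G: "{0, 1, 2, 6} \<subseteq> G"
    and F': "{0, 1} \<subseteq> F'"
    and d: "d \<in> G'" "d \<notin> G" "d \<in> {3, 4, 5, 7, 8, 9}"
      "\<not> (0 \<in> G' \<and> {2, 3, 4, 5} \<subseteq> F') \<Longrightarrow> d \<in> {7, 8, 9} \<and> opp m d \<in> {7, 8, 9}"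
      "\<not> (1 \<in> G' \<and> {6, 7, 8, 9} \<subseteq> F') \<Longrightarrow> d \<in> {3, 4, 5} \<and> opp m d \<in> {3, 4, 5}"
  shows "\<not> isomorphic_hmap (submap m {..<10} G) (submap m F' G')"
proof
  assume "isomorphic_hmap (submap m {..<10} G) (submap m F' G')"
  then obtain h where h: "hmap_iso h (submap m {..<10} G) (submap m F' G')"
    by (auto simp: isomorphic_hmap_def)
  have sel: "nxt m = table [1, 0, 3, 4, 5, 2, 7, 8, 9, 6]" "root m = 0" "opp m 0 = 2" "opp m 1 = 6"
    using m by (auto simp: table_def gluing1_def gluing2_def)
  have opp_d: "opp m d \<in> {3, 4, 5, 7, 8, 9}" "opp m d < 10" "d < 10"
    using m d(3) by (auto simp: table_def gluing1_def gluing2_def)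
  have nxt: "h (Inl y) = Inl y" if "h (Inl x) = Inl x" "x < 10" "x \<in> F'" "y = nxt m x" for x y
    using submap_iso_nxt[OF h that(1)] that by simp
  have 0: "h (Inl 0) = Inl 0"
    using h sel(2) by (simp add: hmap_iso_def submap_def)
  have 1: "h (Inl 1) = Inl 1"
    by (rule nxt[OF 0]) (use F' in \<open>simp_all add: sel table_def\<close>)
  have left: "h (Inl 3) = Inl 3 \<and> h (Inl 4) = Inl 4 \<and> h (Inl 5) = Inl 5"
    if "0 \<in> G' \<and> {2, 3, 4, 5} \<subseteq> F'"
  proof -
    have 2: "h (Inl 2) = Inl 2"
      using submap_iso_opp[OF h 0] G that by (simp add: sel)
    have 3: "h (Inl 3) = Inl 3"
      by (rule nxt[OF 2]) (use that in \<open>simp_all add: sel table_def\<close>)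
    have 4: "h (Inl 4) = Inl 4"
      by (rule nxt[OF 3]) (use that in \<open>simp_all add: sel table_def\<close>)
    have "h (Inl 5) = Inl 5"
      by (rule nxt[OF 4]) (use that in \<open>simp_all add: sel table_def\<close>)
    with 3 4 show ?thesis by simp
  qed
  have right: "h (Inl 7) = Inl 7 \<and> h (Inl 8) = Inl 8 \<and> h (Inl 9) = Inl 9"
    if "1 \<in> G' \<and> {6, 7, 8, 9} \<subseteq> F'"
  proof -
    have 6: "h (Inl 6) = Inl 6"
      using submap_iso_opp[OF h 1] G that sel(4) by simp
    have 7: "h (Inl 7) = Inl 7"
      by (rule nxt[OF 6]) (use that in \<open>simp_all add: sel table_def\<close>)
    have 8: "h (Inl 8) = Inl 8"
      by (rule nxt[OF 7]) (use that in \<open>simp_all add: sel table_def\<close>)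
    have "h (Inl 9) = Inl 9"
      by (rule nxt[OF 8]) (use that in \<open>simp_all add: sel table_def\<close>)
    with 7 8 show ?thesis by simp
  qed
  have fixed: "h (Inl x) = Inl x" if "x \<in> {3, 4, 5, 7, 8, 9}"
    "\<not> (0 \<in> G' \<and> {2, 3, 4, 5} \<subseteq> F') \<Longrightarrow> x \<in> {7, 8, 9}"
    "\<not> (1 \<in> G' \<and> {6, 7, 8, 9} \<subseteq> F') \<Longrightarrow> x \<in> {3, 4, 5}" for x
  proof -
    consider "x \<in> {3, 4, 5}" | "x \<in> {7, 8, 9}" using \<open>x \<in> {3, 4, 5, 7, 8, 9}\<close> by blast
    then show ?thesis
    proof cases
      case 1
      then have "x \<notin> {7, 8, 9}" by auto
      then show ?thesis using left that(2) 1 by blast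
    next
      case 2
      then have "x \<notin> {3, 4, 5}" by auto
      then show ?thesis using right that(3) 2 by blast
    qed
  qed
  have "h (Inl d) = Inl d" "h (Inl (opp m d)) = Inl (opp m d)"
    by (rule fixed[OF d(3)], erule d(4)[THEN conjunct1], erule d(5)[THEN conjunct1],
        rule fixed[OF opp_d(1)], erule d(4)[THEN conjunct2], erule d(5)[THEN conjunct2])
  then have "d \<in> G"
    using submap_iso_glued[OF h] opp_d d(1) by simp
  with d(2) show False by simp
qed


text \<open>The last assumption lists the ways in which \<open>d\<close> can be the first inner side
  peeled: after one of the two root sides, or after both in either order. The conditions on
  \<open>opp m d\<close> place both sides of the wrong edge in one inner face, so that they can be
  located from the root once this face is attached.\<close>

lemma exploration_wrong_gluing:
  assumes m: "m = two_face_map os" "os \<in> {gluing1, gluing2}"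
    and G: "{0, 1, 2, 6} \<subseteq> G" "G \<subseteq> {..<10}" "card G = 6"
    and d: "d \<in> {3, 4, 5, 7, 8, 9} - G" "d \<in> {3, 4, 5} \<Longrightarrow> opp m d \<in> {3, 4, 5}"
      "d \<in> {7, 8, 9} \<Longrightarrow> opp m d \<in> {7, 8, 9}"
    and A: "A (submap m {0, 1} {}) = Inr 0 \<and>
        (A (submap m {0, 1, 2, 3, 4, 5} {0, 2}) = Inr d \<and> d \<in> {3, 4, 5} \<or>
         A (submap m {0, 1, 2, 3, 4, 5} {0, 2}) = Inr 1 \<and>
           A (submap m {0, 1, 2, 3, 4, 5, 6, 7, 8, 9} {0, 1, 2, 6}) = Inr d) \<or>
      A (submap m {0, 1} {}) = Inr 1 \<and>
        (A (submap m {0, 1, 6, 7, 8, 9} {1, 6}) = Inr d \<and> d \<in> {7, 8, 9} \<or>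
         A (submap m {0, 1, 6, 7, 8, 9} {1, 6}) = Inr 0 \<and>
           A (submap m {0, 1, 2, 3, 4, 5, 6, 7, 8, 9} {0, 1, 2, 6}) = Inr d)"
  shows "\<not> isomorphic_hmap (submap m {..<10} G) (exploration A m n)"
proof -
  let ?e1 = "({0, 1, 2, 3, 4, 5}, {0, 2}) :: nat set \<times> nat set"
  let ?e1' = "({0, 1, 6, 7, 8, 9}, {1, 6}) :: nat set \<times> nat set"
  let ?e2 = "({0, 1, 2, 3, 4, 5, 6, 7, 8, 9}, {0, 1, 2, 6}) :: nat set \<times> nat set"
  have o: "opp m 0 = 2" "opp m 1 = 6"
    using m by (auto simp: table_def gluing1_def gluing2_def)
  have f2: "face_at m 2 = {2, 3, 4, 5}" and f6: "face_at m 6 = {6, 7, 8, 9}"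
    by (simp_all add: m(1) face_at_two_face_map)
  have s0: "peel_state A m 0 = ({0, 1}, {})"
    by (simp add: m(1) root_face_two_face_map)
  have holes: "holes (submap m F H) \<noteq> {}" if "x \<in> F - H" for F H x
    using that by (auto simp: submap_def)
  have step: "peel_state A m (Suc k) = (if opp m x \<notin> F then (F \<union> face_at m (opp m x), H \<union> {x, opp m x})
      else (F, H \<union> {x, opp m x}))"
    if "peel_state A m k = (F, H)" "A (submap m F H) = Inr x" "x \<in> F - H" for k F H x
    using that holes[OF that(3)] by (simp add: Let_def)
  have s1: "peel_state A m 1 = ?e1" if "A (submap m {0, 1} {}) = Inr 0"
    using step[OF s0 that] by (simp add: o f2 insert_commute)
  have s1': "peel_state A m 1 = ?e1'" if "A (submap m {0, 1} {}) = Inr 1"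
    using step[OF s0 that] o f6 by (simp add: insert_commute del: peel_state.simps)
  have s2: "peel_state A m 2 = ?e2"
    if "A (submap m {0, 1} {}) = Inr 0" "A (submap m {0, 1, 2, 3, 4, 5} {0, 2}) = Inr 1"
    using step[OF s1[OF that(1)] that(2), unfolded Suc_1] o f6 by (simp add: insert_commute del: peel_state.simps)
  have s2': "peel_state A m 2 = ?e2"
    if "A (submap m {0, 1} {}) = Inr 1" "A (submap m {0, 1, 6, 7, 8, 9} {1, 6}) = Inr 0"
    using step[OF s1'[OF that(1)] that(2), unfolded Suc_1] o f2 by (simp add: insert_commute del: peel_state.simps)
  \<comment> \<open>The submap with \<open>G\<close> has 10 + 4 = 14 darts, whereas the four states
    have 4, 10, 10 and 16.\<close>
  have small: "\<not> isomorphic_hmap (submap m {..<10} G) (exploration A m k)"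
    if "peel_state A m k \<in> {({0, 1}, {}), ?e1, ?e1', ?e2}" for k
  proof
    assume iso: "isomorphic_hmap (submap m {..<10} G) (exploration A m k)"
    obtain F H where FH: "peel_state A m k = (F, H)" by fastforce
    have "card ({..<10} - G) = 4"
      using G(2,3) by (subst card_Diff_subset) (auto intro: finite_subset)
    moreover have "finite F" "card F + card (F - H) \<noteq> 14"
      using that by (auto simp: FH insert_Diff_if)
    ultimately show False
      using isomorphic_submap_card[of m "{..<10}" G F H] iso by (simp add: exploration_def FH)
  qed
  \<comment> \<open>Revealed faces and glued edges only accumulate. Once \<open>d\<close> is glued
    and its face attached to the root face, the obstruction therefore persists at all later
    times.\<close>
  have large: "\<not> isomorphic_hmap (submap m {..<10} G) (exploration A m k)"
    if j: "peel_state A m j = (F, H)" "j \<le> k" "{0, 1} \<subseteq> F" "d \<in> H"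
      and L: "0 \<in> H \<and> {2, 3, 4, 5} \<subseteq> F \<or> d \<in> {7, 8, 9}"
      and R: "1 \<in> H \<and> {6, 7, 8, 9} \<subseteq> F \<or> d \<in> {3, 4, 5}" for j k F H
  proof -
    obtain F' H' where k: "peel_state A m k = (F', H')" by fastforce
    have sub: "F \<subseteq> F'" "H \<subseteq> H'" using peel_state_mono[OF j(2), of A m] by (simp_all add: j(1) k)
    have "\<not> isomorphic_hmap (submap m {..<10} G) (submap m F' H')"
    proof (rule wrong_gluing_not_isomorphic[OF m G(1), where d = d])
      show "{0, 1} \<subseteq> F'" using j(3) sub(1) by (rule subset_trans)
      show "d \<in> H'" using j(4) sub(2) by blast
      show "d \<notin> G" using d(1) by blast
      show "d \<in> {3, 4, 5, 7, 8, 9}" using d(1) by blast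
      assume "\<not> (0 \<in> H' \<and> {2, 3, 4, 5} \<subseteq> F')"
      then have side: "d \<in> {7, 8, 9}" using L subset_trans[OF _ sub(1)] subsetD[OF sub(2)] by metis
      show "d \<in> {7, 8, 9} \<and> opp m d \<in> {7, 8, 9}" using side d(3)[OF side] by (rule conjI)
    next
      assume "\<not> (1 \<in> H' \<and> {6, 7, 8, 9} \<subseteq> F')"
      then have side: "d \<in> {3, 4, 5}" using R subset_trans[OF _ sub(1)] subsetD[OF sub(2)] by metis
      show "d \<in> {3, 4, 5} \<and> opp m d \<in> {3, 4, 5}" using side d(2)[OF side] by (rule conjI)
    qed
    then show ?thesis by (simp add: exploration_def k)
  qed
  have later: "\<not> isomorphic_hmap (submap m {..<10} G) (exploration A m k)"
    if j: "peel_state A m j = (F, H)" "A (submap m F H) = Inr d" "d \<in> F" "d \<notin> H"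
      and "j < k" "{0, 1} \<subseteq> F"
      and "0 \<in> H \<and> {2, 3, 4, 5} \<subseteq> F \<or> d \<in> {7, 8, 9}"
      and "1 \<in> H \<and> {6, 7, 8, 9} \<subseteq> F \<or> d \<in> {3, 4, 5}" for j k F H
  proof -
    obtain F' where F': "peel_state A m (Suc j) = (F', H \<union> {d, opp m d})" "F \<subseteq> F'"
      using step[OF j(1,2)] j(3,4) by (auto split: if_splits)
    show ?thesis
    proof (rule large[OF F'(1)])
      show "Suc j \<le> k" using that(5) by simp
      show "{0, 1} \<subseteq> F'" using that(6) F'(2) by (rule subset_trans)
      show "0 \<in> H \<union> {d, opp m d} \<and> {2, 3, 4, 5} \<subseteq> F' \<or> d \<in> {7, 8, 9}"
        using that(7) subset_trans[OF _ F'(2)] by blast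
      show "1 \<in> H \<union> {d, opp m d} \<and> {6, 7, 8, 9} \<subseteq> F' \<or> d \<in> {3, 4, 5}"
        using that(8) subset_trans[OF _ F'(2)] by blast
    qed simp
  qed
  have d2: "d \<in> {3, 4, 5, 7, 8, 9}" "d \<notin> {0, 1, 2, 6}" using d(1) by auto
  from A show ?thesis
  proof (elim disjE conjE)
    assume A: "A (submap m {0, 1} {}) = Inr 0"
      "A (submap m {0, 1, 2, 3, 4, 5} {0, 2}) = Inr d" "d \<in> {3, 4, 5}"
    consider "n = 0" | "n = 1" | "1 < n" by linarith
    then show ?thesis
    proof cases
      case 3
      show ?thesis
        by (rule later[OF s1[OF A(1)] A(2) _ _ 3]) (use A(3) in auto)
    qed (use small[of n] s0 s1[OF A(1)] in \<open>simp_all del: peel_state.simps\<close>)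
  next
    assume A: "A (submap m {0, 1} {}) = Inr 1"
      "A (submap m {0, 1, 6, 7, 8, 9} {1, 6}) = Inr d" "d \<in> {7, 8, 9}"
    consider "n = 0" | "n = 1" | "1 < n" by linarith
    then show ?thesis
    proof cases
      case 3
      show ?thesis
        by (rule later[OF s1'[OF A(1)] A(2) _ _ 3]) (use A(3) in auto)
    qed (use small[of n] s0 s1'[OF A(1)] in \<open>simp_all del: peel_state.simps\<close>)
  next
    assume A: "A (submap m {0, 1} {}) = Inr 0"
      "A (submap m {0, 1, 2, 3, 4, 5} {0, 2}) = Inr 1"
      "A (submap m {0, 1, 2, 3, 4, 5, 6, 7, 8, 9} {0, 1, 2, 6}) = Inr d"
    consider "n = 0" | "n = 1" | "n = 2" | "2 < n" by linarith
    then show ?thesis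
    proof cases
      case 4
      show ?thesis
        by (rule later[OF s2[OF A(1,2)] A(3) _ _ 4]) (use d2 in auto)
    qed (use small[of n] s0 s1[OF A(1)] s2[OF A(1,2)] in \<open>simp_all del: peel_state.simps\<close>)
  next
    assume A: "A (submap m {0, 1} {}) = Inr 1"
      "A (submap m {0, 1, 6, 7, 8, 9} {1, 6}) = Inr 0"
      "A (submap m {0, 1, 2, 3, 4, 5, 6, 7, 8, 9} {0, 1, 2, 6}) = Inr d"
    consider "n = 0" | "n = 1" | "n = 2" | "2 < n" by linarith
    then show ?thesis
    proof cases
      case 4
      show ?thesis
        by (rule later[OF s2'[OF A(1,2)] A(3) _ _ 4]) (use d2 in auto)
    qed (use small[of n] s0 s1'[OF A(1)] s2'[OF A(1,2)] in \<open>simp_all del: peel_state.simps\<close>)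
  qed
qed

text \<open>\<open>A1\<close> and \<open>A2\<close> stand for the pull-backs of \<open>A\<close>
  along the labellings under which the two maps are met. They may differ elsewhere, but both follow
  \<open>A\<close> in the four shared states.\<close>

lemma no_common_algorithm:
  assumes A: "peeling_algorithm A"
    and A12: "\<And>e. quadrangulation_with_holes e \<Longrightarrow> holes e \<noteq> {} \<Longrightarrow> \<Union>(holes e) \<subseteq> range Inr \<Longrightarrow>
      A1 e = A e \<and> A2 e = A e"
  shows "(\<forall>n. \<not> isomorphic_hmap (right_submap (two_face_map gluing1))
        (exploration A1 (two_face_map gluing1) n)) \<or>
    (\<forall>n. \<not> isomorphic_hmap (right_submap (two_face_map gluing2))
        (exploration A2 (two_face_map gluing2) n))"
proof -
  let ?m1 = "two_face_map gluing1" and ?m2 = "two_face_map gluing2"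
  let ?start = "({0, 1}, {}) :: nat set \<times> nat set"
  let ?left = "({0, 1, 2, 3, 4, 5}, {0, 2}) :: nat set \<times> nat set"
  let ?right = "({0, 1, 6, 7, 8, 9}, {1, 6}) :: nat set \<times> nat set"
  let ?both = "({0, 1, 2, 3, 4, 5, 6, 7, 8, 9}, {0, 1, 2, 6}) :: nat set \<times> nat set"
  \<comment> \<open>Hole contours never leave the \<open>Inr\<close> side, as the agreement
    assumption requires.\<close>
  have submap_holes: "\<Union>(holes (submap m F H)) \<subseteq> range Inr" for m :: "nat hmap" and F H
  proof -
    have "(submap_nxt m F H ^^ k) (Inr d) \<in> range Inr" for k d
      by (induction k) (auto simp: submap_nxt_def)
    then show ?thesis by (auto simp: submap_def orbit_altdef)
  qed
  have in_state: "A (submap ?m1 F H) \<in> Inr ` (F - H) \<and>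
      A1 (submap ?m1 F H) = A (submap ?m1 F H) \<and> A2 (submap ?m2 F H) = A (submap ?m1 F H)"
    if "(F, H) \<in> {?start, ?left, ?right, ?both}" for F H
  proof -
    let ?e = "submap ?m1 F H"
    have q: "quadrangulation_with_holes ?e" and ne: "F - H \<noteq> {}"
    proof -
      from that have "quadrangulation_with_holes ?e \<and> F - H \<noteq> {}"
      proof (elim insertE emptyE)
      qed (simp_all only: prod.inject quadrangulation_with_holes_submap, simp_all)
      then show "quadrangulation_with_holes ?e" "F - H \<noteq> {}" by blast+
    qed
    have h: "holes ?e \<noteq> {}" using ne by (simp add: submap_def)
    have "\<Union>(holes ?e) \<subseteq> darts ?e"
    proof -
      have n: "nxt ?e permutes darts ?e" and hf: "holes ?e \<subseteq> faces ?e"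
        using q by (auto simp: quadrangulation_with_holes_def planar_map_def)
      have "face_at ?e x \<subseteq> darts ?e" if "x \<in> darts ?e" for x
        unfolding face_at_def using permutes_orbit_subset[OF n that] .
      then show ?thesis using hf by (fastforce simp: faces_def)
    qed
    moreover have "A ?e \<in> \<Union>(holes ?e)" using A q h by (simp add: peeling_algorithm_def)
    ultimately have "A ?e \<in> darts ?e" "A ?e \<in> range Inr" using submap_holes by blast+
    then have "A ?e \<in> Inr ` (F - H)" by (auto simp: submap_def)
    moreover have "submap ?m2 F H = ?e" using submap_gluing_cong[OF that] by (rule sym)
    ultimately show ?thesis using A12[OF q h submap_holes] by simp
  qed
  define a where "a = (\<lambda>(F, H). projr (A (submap ?m1 F H)))"
  have a: "A1 (submap ?m1 F H) = Inr (a (F, H))" "A2 (submap ?m2 F H) = Inr (a (F, H))" "a (F, H) \<in> F - H"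
    if "(F, H) \<in> {?start, ?left, ?right, ?both}" for F H
    using in_state[OF that] unfolding a_def prod.case by (metis imageE sum.sel(2))+
  have choices: "a ?start \<in> {0, 1}" "a ?left \<in> {1, 3, 4, 5}" "a ?right \<in> {0, 7, 8, 9}"
    "a ?both \<in> {3, 4, 5, 7, 8, 9}"
    using a(3)[of "fst ?start" "snd ?start"] a(3)[of "fst ?left" "snd ?left"]
      a(3)[of "fst ?right" "snd ?right"] a(3)[of "fst ?both" "snd ?both"]
    by (simp_all add: insert_Diff_if)
  then have a1: "a ?left = 1 \<or> a ?left \<in> {3, 4, 5}" and a1': "a ?right = 0 \<or> a ?right \<in> {7, 8, 9}"
    by blast+
  note a0 = choices(1) and a2 = choices(4)
  \<comment> \<open>Splits a statement about all four states into one for each, to serve as rewrite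
    rules for the choices.\<close>
  have choose: "P ?start" "P ?left" "P ?right" "P ?both"
    if "\<And>F H. (F, H) \<in> {?start, ?left, ?right, ?both} \<Longrightarrow> P (F, H)" for P
    using that by simp_all
  note a1_eqs = choose[of "\<lambda>(F, H). A1 (submap ?m1 F H) = Inr (a (F, H))", unfolded prod.case, OF a(1)]
  note a2_eqs = choose[of "\<lambda>(F, H). A2 (submap ?m2 F H) = Inr (a (F, H))", unfolded prod.case, OF a(2)]
  \<comment> \<open>The first side other than 0 and 1 that the common choices select.\<close>
  define d where "d = (if a ?start = 0 then if a ?left = 1 then a ?both else a ?left
    else if a ?right = 0 then a ?both else a ?right)"
  have d: "d \<in> {3, 4, 5, 7, 8, 9}" using a1 a1' a2 by (auto simp: d_def)
  have sel: "a ?start = 0 \<and> (a ?left = d \<and> d \<in> {3, 4, 5} \<or> a ?left = 1 \<and> a ?both = d) \<or>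
      a ?start = 1 \<and> (a ?right = d \<and> d \<in> {7, 8, 9} \<or> a ?right = 0 \<and> a ?both = d)"
    using a0 a1 a1' by (auto simp: d_def)
  show ?thesis
  proof (cases "d \<in> {0, 1, 2, 6, 3, 7 :: nat}")
    case False
    have "\<not> isomorphic_hmap (submap ?m1 {..<10} {0, 1, 2, 6, 3, 7}) (exploration A1 ?m1 n)" for n
    proof (rule exploration_wrong_gluing[OF refl, where d = d])
      show "d \<in> {3, 4, 5, 7, 8, 9} - {0, 1, 2, 6, 3, 7}" using d False by blast
      show "opp ?m1 d \<in> {3, 4, 5}" if "d \<in> {3, 4, 5}"
        using that False by (auto simp: table_def gluing1_def)
      show "opp ?m1 d \<in> {7, 8, 9}" if "d \<in> {7, 8, 9}"
        using that False by (auto simp: table_def gluing1_def)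
      show "A1 (submap ?m1 {0, 1} {}) = Inr 0 \<and>
          (A1 (submap ?m1 {0, 1, 2, 3, 4, 5} {0, 2}) = Inr d \<and> d \<in> {3, 4, 5} \<or>
           A1 (submap ?m1 {0, 1, 2, 3, 4, 5} {0, 2}) = Inr 1 \<and>
             A1 (submap ?m1 {0, 1, 2, 3, 4, 5, 6, 7, 8, 9} {0, 1, 2, 6}) = Inr d) \<or>
        A1 (submap ?m1 {0, 1} {}) = Inr 1 \<and>
          (A1 (submap ?m1 {0, 1, 6, 7, 8, 9} {1, 6}) = Inr d \<and> d \<in> {7, 8, 9} \<or>
           A1 (submap ?m1 {0, 1, 6, 7, 8, 9} {1, 6}) = Inr 0 \<and>
             A1 (submap ?m1 {0, 1, 2, 3, 4, 5, 6, 7, 8, 9} {0, 1, 2, 6}) = Inr d)"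
        using sel by (simp only: a1_eqs sum.inject)
    qed simp_all
    then show ?thesis by (simp add: right_submap_gluing1)
  next
    case True
    \<comment> \<open>Here \<open>d\<close> is 3 or 7, whereas the second map keeps 5 and 9.\<close>
    then have False': "d \<notin> {0, 1, 2, 6, 5, 9}" using d by auto
    have "\<not> isomorphic_hmap (submap ?m2 {..<10} {0, 1, 2, 6, 5, 9}) (exploration A2 ?m2 n)" for n
    proof (rule exploration_wrong_gluing[OF refl, where d = d])
      show "d \<in> {3, 4, 5, 7, 8, 9} - {0, 1, 2, 6, 5, 9}" using d False' by blast
      show "opp ?m2 d \<in> {3, 4, 5}" if "d \<in> {3, 4, 5}"
        using that False' by (auto simp: table_def gluing2_def)
      show "opp ?m2 d \<in> {7, 8, 9}" if "d \<in> {7, 8, 9}"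
        using that False' by (auto simp: table_def gluing2_def)
      show "A2 (submap ?m2 {0, 1} {}) = Inr 0 \<and>
          (A2 (submap ?m2 {0, 1, 2, 3, 4, 5} {0, 2}) = Inr d \<and> d \<in> {3, 4, 5} \<or>
           A2 (submap ?m2 {0, 1, 2, 3, 4, 5} {0, 2}) = Inr 1 \<and>
             A2 (submap ?m2 {0, 1, 2, 3, 4, 5, 6, 7, 8, 9} {0, 1, 2, 6}) = Inr d) \<or>
        A2 (submap ?m2 {0, 1} {}) = Inr 1 \<and>
          (A2 (submap ?m2 {0, 1, 6, 7, 8, 9} {1, 6}) = Inr d \<and> d \<in> {7, 8, 9} \<or>
           A2 (submap ?m2 {0, 1, 6, 7, 8, 9} {1, 6}) = Inr 0 \<and>
             A2 (submap ?m2 {0, 1, 2, 3, 4, 5, 6, 7, 8, 9} {0, 1, 2, 6}) = Inr d)"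
        using sel by (simp only: a2_eqs sum.inject)
    qed simp_all
    then show ?thesis by (simp add: right_submap_gluing2)
  qed
qed

section \<open>From the random map to the two fixed maps\<close>

theorem proposition7p2:
  fixes q :: real and M :: "'w measure" and Q :: "'w \<Rightarrow> nat hmap"
  assumes "0 < q" and "q \<le> 1 / 12"
    and "boltzmann_map q 1 M Q"
  shows "\<not> (\<exists>(A :: (nat + nat) hmap \<Rightarrow> nat + nat) (\<tau> :: 'w \<Rightarrow> enat).
            peeling_algorithm A \<and>
            stopping_time (exploration_filtration A M Q) \<tau> \<and>
            (AE \<omega> in M. \<exists>n. \<tau> \<omega> = enat n \<and>
               isomorphic_hmap (right_submap (Q \<omega>)) (exploration A (Q \<omega>) n)))"
proof
  assume "\<exists>(A :: (nat + nat) hmap \<Rightarrow> nat + nat) (\<tau> :: 'w \<Rightarrow> enat).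
            peeling_algorithm A \<and>
            stopping_time (exploration_filtration A M Q) \<tau> \<and>
            (AE \<omega> in M. \<exists>n. \<tau> \<omega> = enat n \<and>
               isomorphic_hmap (right_submap (Q \<omega>)) (exploration A (Q \<omega>) n))"
  then obtain A :: "(nat + nat) hmap \<Rightarrow> nat + nat" and \<tau> where A: "peeling_algorithm A"
    and "AE \<omega> in M. \<exists>n. \<tau> \<omega> = enat n \<and>
      isomorphic_hmap (right_submap (Q \<omega>)) (exploration A (Q \<omega>) n)"
    by blast
  then have ae: "AE \<omega> in M. \<exists>n. isomorphic_hmap (right_submap (Q \<omega>)) (exploration A (Q \<omega>) n)"
    by (auto elim: eventually_mono)
  interpret prob_space M using assms(3) by (simp add: boltzmann_map_def)
  \<comment> \<open>One good outcome per map is enough: an isomorphism class of positive probability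
    is not contained in the null set of exceptions. The function \<open>A'\<close> depends on the
    labels of that outcome.\<close>
  have realized: "\<exists>A'. (\<forall>e. quadrangulation_with_holes e \<longrightarrow> holes e \<noteq> {} \<longrightarrow>
        \<Union>(holes e) \<subseteq> range Inr \<longrightarrow> A' e = A e) \<and>
      (\<exists>n. isomorphic_hmap (right_submap (two_face_map os)) (exploration A' (two_face_map os) n))"
    if os: "os \<in> {gluing1, gluing2}" for os
  proof -
    let ?m = "two_face_map os"
    have m: "quadrangulation 1 ?m" using os by (rule quadrangulation_two_face_map)
    have pm: "planar_map ?m" using os by (rule planar_two_face_map)
    let ?S = "{\<omega> \<in> space M. isomorphic_hmap (Q \<omega>) ?m}"
    have pos: "measure M ?S > 0"
      using assms(1,3) m unfolding boltzmann_map_def by auto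
    have "\<exists>\<omega>\<in>?S. \<exists>n. isomorphic_hmap (right_submap (Q \<omega>)) (exploration A (Q \<omega>) n)"
    proof (rule ccontr)
      assume no: "\<not> ?thesis"
      \<comment> \<open>Monotonicity of the measure asks for a measurable larger set, so the
        exceptions are enclosed in a measurable null set.\<close>
      obtain N where N: "{\<omega> \<in> space M. \<not> (\<exists>n. isomorphic_hmap (right_submap (Q \<omega>))
          (exploration A (Q \<omega>) n))} \<subseteq> N" "emeasure M N = 0" "N \<in> sets M"
        using ae by (rule AE_E)
      have "?S \<subseteq> N" using no N(1) by blast
      then have "emeasure M ?S = 0" using emeasure_mono[of ?S N M] N(2,3) by simp
      then have "measure M ?S = 0" by (simp add: measure_def)
      with pos show False by simp
    qed
    then obtain \<omega> n where \<omega>: "\<omega> \<in> space M" "isomorphic_hmap (Q \<omega>) ?m"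
      and iso: "isomorphic_hmap (right_submap (Q \<omega>)) (exploration A (Q \<omega>) n)" by blast
    have "quadrangulation 1 (Q \<omega>)"
      using assms(3) \<omega>(1) unfolding boltzmann_map_def by (auto dest: measurable_space)
    then obtain h where h: "bij h" "?m = relabel h (Q \<omega>)"
      using isomorphic_hmap_imp_relabel[of "Q \<omega>" ?m] \<omega>(2) m
      by (auto simp: quadrangulation_def)
    \<comment> \<open>The inverse presents the outcome as a relabelling of the fixed map, the form
      in which equivariance carries its exploration back to that map.\<close>
    define g where "g = inv h"
    have g: "bij g" "Q \<omega> = relabel g ?m"
      using h by (simp_all add: g_def bij_imp_bij_inv relabel_inv)
    have "bij (nxt ?m)" using pm by (auto simp: planar_map_def intro: permutes_bij)
    then have "isomorphic_hmap (right_submap ?m) (exploration (pull_back_algorithm g A) ?m n)"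
      using isomorphic_right_submap_relabelD[OF g(1)] iso g(2) by metis
    moreover have "pull_back_algorithm g A e = A e"
      if "quadrangulation_with_holes e" "holes e \<noteq> {}" "\<Union>(holes e) \<subseteq> range Inr" for e
      using pull_back_algorithm_eq[OF g(1) A that] .
    ultimately show ?thesis by blast
  qed
  obtain A1 where A1: "\<And>e. quadrangulation_with_holes e \<Longrightarrow> holes e \<noteq> {} \<Longrightarrow>
        \<Union>(holes e) \<subseteq> range Inr \<Longrightarrow> A1 e = A e"
      "\<exists>n. isomorphic_hmap (right_submap (two_face_map gluing1)) (exploration A1 (two_face_map gluing1) n)"
    using realized[of gluing1] by auto
  obtain A2 where A2: "\<And>e. quadrangulation_with_holes e \<Longrightarrow> holes e \<noteq> {} \<Longrightarrow>
        \<Union>(holes e) \<subseteq> range Inr \<Longrightarrow> A2 e = A e"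
      "\<exists>n. isomorphic_hmap (right_submap (two_face_map gluing2)) (exploration A2 (two_face_map gluing2) n)"
    using realized[of gluing2] by auto
  show False
    using no_common_algorithm[OF A, of A1 A2] A1 A2 by blast
qed

end
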